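(* Consider the subgradient-push algorithm (described in the context) over a directed graph sequence $\{\mathbb{G}(t)\}_{t\ge 0}$ that is uniformly strongly connected, and let $z^*$ be a minimizer of $f$. 1) Suppose the stepsize sequence $\{\alpha(t)\}_{t\ge0}$ is positive, non-increasing, and satisfies $\sum_{t=0}^\infty \alpha(t)=\infty$ and $\sum_{t=0}^\infty\alpha^2(t)<\infty$, and that $\|g_i(t)\|_2$ is uniformly bounded over all $i\in\mathcal V$ and $t\ge 0$. Then $$\lim_{t\to\infty} f\left(\frac{\sum_{\tau=0}^t\alpha(\tau)\bar z(\tau)}{\sum_{\tau=0}^t\alpha(\tau)}\right)=f(z^* ).$$ 2) Suppose that, for each integer $T>0$, the algorithm is run for $T$ steps with the fixed stepsize $\alpha(t)=1/\sqrt{T}$, $t\in\{0,1,\ldots,T-1\}$ (with the same functions, graphs, weights and initial values $x_i(0)$ for all $T$), and that $\|g_i(t)\|_2$ is uniformly bounded over all $i$ and $t$ (by a bound not depending on $T$). Then $$f\left(\frac{\sum_{\tau=0}^{T-1}\bar z(\tau)}{T}\right)-f(z^* )\le O\left(\frac{1}{\sqrt T}\right),$$ i.e. there is a constant $C$ independent of $T$ such that the left-hand side is at most $C/\sqrt T$ for all $T>0$.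
   Context: Network and weights. There are $n$ agents, $\mathcal V=\{1,\dots,n\}$. For each integer $t\ge0$, $\mathbb G(t)=(\mathcal V,\mathcal E(t))$ is a directed graph with self-arcs at all vertices. $\mathcal N_i(t)=\{j:(j,i)\in\mathcal E(t)\}$ and $\mathcal N_i^-(t)=\{k:(i,k)\in\mathcal E(t)\}$ are the in- and out-neighbor sets of $i$ (both contain $i$). The weights satisfy: there is a constant $\beta>0$ such that $w_{ij}(t)\ge\beta$ for all $i,t$ and $j\in\mathcal N_i(t)$; $w_{ij}(t)=0$ if $j\notin\mathcal N_i(t)$; and $\sum_{j\in\mathcal N_i^-(t)}w_{ji}(t)=1$ for all $i,t$. Uniform strong connectivity. $\{\mathbb G(t)\}$ is uniformly strongly connected if there is a positive integer $L$ such that for every $t\ge0$ the union graph $\cup_{k=t}^{t+L-1}\mathbb G(k)$ (vertex set $\mathcal V$, union of the edge sets) is strongly connected. Problem. Each $f_i:\mathbb R^d\to\mathbb R$ is convex (not necessarily differentiable), $f(z)=\frac1n\sum_{i=1}^n f_i(z)$, and the set of minimizers of $f$ is assumed nonempty. A subgradient of a convex $h:\mathbb R^d\to\mathbb R$ at $x$ is a vector $g$ with $h(y)\ge h(x)+g^\top(y-x)$ for all $y\in\mathbb R^d$. Subgradient-push algorithm. With arbitrary $x_i(0)\in\mathbb R^d$ and $y_i(0)=1$, $$x_i(t+1)=\sum_{j\in\mathcal N_i(t)}w_{ij}(t)\big[x_j(t)-\alpha(t)g_j(t)\big],\qquad y_i(t+1)=\sum_{j\in\mathcal N_i(t)}w_{ij}(t)y_j(t),$$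 where $\alpha(t)>0$ is the stepsize and $g_j(t)$ is a subgradient of $f_j$ at $x_j(t)/y_j(t)$. Define $z_i(t)=x_i(t)/y_i(t)$ and $\bar z(t)=\frac1n\sum_{i=1}^n z_i(t)$. *)

theory Defs
  imports "HOL-Analysis.Analysis" "Graph_Theory.Digraph_Component"
begin

text \<open>
  The agents are the elements of a finite type \<open>'n\<close>, so that \<open>n = CARD('n) \<ge> 1\<close>. A time-varying
  directed graph on them is given by its arc sets \<open>E t\<close>; \<open>(j, i) \<in> E t\<close> is an arc from \<open>j\<close> to \<open>i\<close>.
\<close>

definition in_nbrs :: "(nat \<Rightarrow> ('n \<times> 'n) set) \<Rightarrow> nat \<Rightarrow> 'n \<Rightarrow> 'n set" where
  "in_nbrs E t i = {j. (j, i) \<in> E t}"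

definition out_nbrs :: "(nat \<Rightarrow> ('n \<times> 'n) set) \<Rightarrow> nat \<Rightarrow> 'n \<Rightarrow> 'n set" where
  "out_nbrs E t i = {k. (i, k) \<in> E t}"

definition union_graph :: "(nat \<Rightarrow> ('n \<times> 'n) set) \<Rightarrow> nat set \<Rightarrow> 'n pair_pre_digraph" where
  "union_graph E I = \<lparr>pverts = UNIV, parcs = (\<Union>k\<in>I. E k)\<rparr>"

definition uniformly_strongly_connected :: "(nat \<Rightarrow> ('n \<times> 'n) set) \<Rightarrow> bool" where
  "uniformly_strongly_connected E \<longleftrightarrow>
     (\<exists>L>0. \<forall>t. strongly_connected (with_proj (union_graph E {t..<t + L})))"

text \<open>
  The weight \<open>w\<^sub>i\<^sub>j(t)\<close> is \<open>w t i j\<close>; it belongs to the arc from \<open>j\<close> to \<open>i\<close>. Hence each column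
  of the weight matrix sums to one.
\<close>

definition push_weights ::
  "(nat \<Rightarrow> ('n::finite \<times> 'n) set) \<Rightarrow> (nat \<Rightarrow> 'n \<Rightarrow> 'n \<Rightarrow> real) \<Rightarrow> bool" where
  "push_weights E w \<longleftrightarrow>
     (\<exists>\<beta>>0. \<forall>t i. \<forall>j\<in>in_nbrs E t i. w t i j \<ge> \<beta>) \<and>
     (\<forall>t i j. j \<notin> in_nbrs E t i \<longrightarrow> w t i j = 0) \<and>
     (\<forall>t i. (\<Sum>j\<in>out_nbrs E t i. w t j i) = 1)"

definition is_subgradient :: "('a::real_inner \<Rightarrow> real) \<Rightarrow> 'a \<Rightarrow> 'a \<Rightarrow> bool" where
  "is_subgradient h x g \<longleftrightarrow> (\<forall>y. h y \<ge> h x + g \<bullet> (y - x))"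

definition avg_objective :: "('n::finite \<Rightarrow> 'a \<Rightarrow> real) \<Rightarrow> 'a \<Rightarrow> real" where
  "avg_objective f z = (1 / real CARD('n)) * (\<Sum>i\<in>UNIV. f i z)"

text \<open>
  The iterates are determined by the initial values \<open>x0\<close>, the stepsizes \<open>\<alpha>\<close> and the vectors
  \<open>g t j\<close> used in place of \<open>g\<^sub>j(t)\<close>. That these vectors are subgradients at the current ratios
  \<open>push_z\<close> is the separate condition \<open>subgradient_choice\<close>, which is only imposed at the times
  in \<open>I\<close> at which the algorithm is run. The iterates at times up to \<open>T\<close> depend on \<open>\<alpha> t\<close>
  and \<open>g t\<close> for \<open>t < T\<close> only.
\<close>

primrec push_y ::
  "(nat \<Rightarrow> ('n::finite \<times> 'n) set) \<Rightarrow> (nat \<Rightarrow> 'n \<Rightarrow> 'n \<Rightarrow> real) \<Rightarrow> nat \<Rightarrow> 'n \<Rightarrow> real" where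
  "push_y E w 0 = (\<lambda>i. 1)"
| "push_y E w (Suc t) = (\<lambda>i. \<Sum>j\<in>in_nbrs E t i. w t i j * push_y E w t j)"

primrec push_x ::
  "(nat \<Rightarrow> ('n::finite \<times> 'n) set) \<Rightarrow> (nat \<Rightarrow> 'n \<Rightarrow> 'n \<Rightarrow> real) \<Rightarrow> ('n \<Rightarrow> 'a::real_vector) \<Rightarrow>
   (nat \<Rightarrow> real) \<Rightarrow> (nat \<Rightarrow> 'n \<Rightarrow> 'a) \<Rightarrow> nat \<Rightarrow> 'n \<Rightarrow> 'a" where
  "push_x E w x0 \<alpha> g 0 = x0"
| "push_x E w x0 \<alpha> g (Suc t) =
     (\<lambda>i. \<Sum>j\<in>in_nbrs E t i. w t i j *\<^sub>R (push_x E w x0 \<alpha> g t j - \<alpha> t *\<^sub>R g t j))"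

definition push_z ::
  "(nat \<Rightarrow> ('n::finite \<times> 'n) set) \<Rightarrow> (nat \<Rightarrow> 'n \<Rightarrow> 'n \<Rightarrow> real) \<Rightarrow> ('n \<Rightarrow> 'a::real_vector) \<Rightarrow>
   (nat \<Rightarrow> real) \<Rightarrow> (nat \<Rightarrow> 'n \<Rightarrow> 'a) \<Rightarrow> nat \<Rightarrow> 'n \<Rightarrow> 'a" where
  "push_z E w x0 \<alpha> g t i = push_x E w x0 \<alpha> g t i /\<^sub>R push_y E w t i"

definition push_zbar ::
  "(nat \<Rightarrow> ('n::finite \<times> 'n) set) \<Rightarrow> (nat \<Rightarrow> 'n \<Rightarrow> 'n \<Rightarrow> real) \<Rightarrow> ('n \<Rightarrow> 'a::real_vector) \<Rightarrow>
   (nat \<Rightarrow> real) \<Rightarrow> (nat \<Rightarrow> 'n \<Rightarrow> 'a) \<Rightarrow> nat \<Rightarrow> 'a" where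
  "push_zbar E w x0 \<alpha> g t = (1 / real CARD('n)) *\<^sub>R (\<Sum>i\<in>UNIV. push_z E w x0 \<alpha> g t i)"

definition subgradient_choice ::
  "(nat \<Rightarrow> ('n::finite \<times> 'n) set) \<Rightarrow> (nat \<Rightarrow> 'n \<Rightarrow> 'n \<Rightarrow> real) \<Rightarrow> ('n \<Rightarrow> 'a::real_inner \<Rightarrow> real) \<Rightarrow>
   ('n \<Rightarrow> 'a) \<Rightarrow> (nat \<Rightarrow> real) \<Rightarrow> (nat \<Rightarrow> 'n \<Rightarrow> 'a) \<Rightarrow> nat set \<Rightarrow> bool" where
  "subgradient_choice E w f x0 \<alpha> g I \<longleftrightarrow>
     (\<forall>t\<in>I. \<forall>j. is_subgradient (f j) (push_z E w x0 \<alpha> g t j) (g t j))"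

end

theory Submission
  imports Defs
begin

text \<open>
  Since the weight matrices have unit column sums, the average \<open>x\<^sub>m(t)\<close> of the \<open>x\<^sub>i(t)\<close> performs an
  exact step \<open>x\<^sub>m(t+1) = x\<^sub>m(t) - \<alpha>(t) \<cdot> mean g\<^sub>i(t)\<close>. Only the points at which the subgradients
  are taken are inexact: they are the \<open>z\<^sub>i(t)\<close> and not \<open>x\<^sub>m(t)\<close>. Two facts therefore suffice.

  \<^bold>\<open>The ratios agree up to a summable error.\<close> Dividing by \<open>y\<^sub>i\<close> turns the column-stochastic recursion
  into a row-stochastic one, and uniform strong connectivity makes every product of \<open>n L\<close> consecutive
  matrices entrywise bounded below, so that it contracts differences by a fixed factor
  (\<open>averaging_contracts\<close>). For this \<open>y\<^sub>i\<close> must stay away from zero, which follows from the same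
  positivity argument (\<open>positivity_spreads\<close>, \<open>y_ge\<close>). Hence unit mass inserted at any agent and any
  time is, after division by \<open>y\<close>, spread evenly up to an error \<open>rate m\<close>
  that is summable in the elapsed time \<open>m\<close> (\<open>transition_mixes\<close>). By superposition
  \<open>\<parallel>z\<^sub>i(t) - x\<^sub>m(t)\<parallel>\<close> is at most a multiple of
  \<open>rate t + (\<Sum>s<t. \<alpha> s * rate (t - s))\<close>, and the bound obtained for the \<open>\<alpha>\<close>-weighted sum of these depends
  on the stepsizes only through a bound for \<open>\<Sum> \<alpha>\<^sup>2\<close> (\<open>weighted_disagreement_le\<close>).

  \<^bold>\<open>Descent tolerates such an error.\<close> The usual expansion of \<open>\<parallel>x\<^sub>m - z\<^sup>*\<parallel>\<^sup>2\<close> bounds the weighted sum of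
  \<open>mean (f\<^sub>i(z\<^sub>i)) - f(z\<^sup>*)\<close>. The subgradients are bounded only where the algorithm evaluates them, and
  the \<open>f\<^sub>i\<close> need not be globally Lipschitz, so replacing the different points \<open>z\<^sub>i\<close> by the one point
  \<open>mean z\<^sub>i\<close> requires a proof that the iterates stay bounded. This comes from
  \<open>disagreement_bounds_descent_below\<close>: scaling towards \<open>z\<^sup>*\<close> shows that
  \<open>mean (f\<^sub>i(u\<^sub>i)) - f(z\<^sup>*)\<close> cannot fall below \<open>- K\<close> times the mean distance of the \<open>u\<^sub>i\<close> to a common point,
  where \<open>K\<close> is a Lipschitz constant on the unit ball around \<open>z\<^sup>*\<close> only. Once the iterates lie in a
  fixed ball, convex functions are Lipschitz there.

  Together these bound \<open>\<Sum> \<alpha>(t) (f(mean z\<^sub>i(t)) - f(z\<^sup>*))\<close> by a constant depending on the stepsizes only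
  through a bound for \<open>\<Sum> \<alpha>\<^sup>2\<close>. By Jensen's inequality the gap at the weighted average is at most
  \<open>C / \<Sum> \<alpha>\<close> (\<open>weighted_average_gap\<close>). In the first part \<open>\<Sum> \<alpha>\<close> diverges; in the second \<open>\<Sum> \<alpha>\<^sup>2 = 1\<close> and
  \<open>\<Sum> \<alpha> = \<surd>T\<close>.
\<close>

section \<open>Averages over the agents\<close>

definition mean :: "('n::finite \<Rightarrow> 'a::real_vector) \<Rightarrow> 'a" where
  "mean v = (1 / real CARD('n)) *\<^sub>R (\<Sum>i\<in>UNIV. v i)"

lemma mean_diff: "mean (\<lambda>i. u i - v i) = mean u - mean v"
  by (simp add: mean_def sum_subtractf scaleR_diff_right)

lemma mean_scaleR: "mean (\<lambda>i. c *\<^sub>R v i) = c *\<^sub>R mean v"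
  by (simp add: mean_def scaleR_sum_right mult.commute)

lemma mean_const [simp]: "mean (\<lambda>i::'n::finite. c) = c"
  by (simp add: mean_def sum_constant_scaleR)

lemma mean_inner: "mean v \<bullet> a = mean (\<lambda>i. v i \<bullet> a)"
  by (simp add: mean_def inner_sum_left)

lemma mean_mono:
  fixes u v :: "'n::finite \<Rightarrow> real"
  assumes "\<And>i. u i \<le> v i"
  shows "mean u \<le> mean v"
  using assms by (auto simp: mean_def intro!: divide_right_mono sum_mono)

lemma norm_mean_le:
  fixes v :: "'n::finite \<Rightarrow> 'a::real_normed_vector"
  assumes "\<And>i. norm (v i) \<le> c"
  shows "norm (mean v) \<le> c"
proof -
  have "norm (\<Sum>i\<in>UNIV. v i) \<le> (\<Sum>i\<in>(UNIV::'n set). c)"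
    by (rule sum_norm_le) (use assms in auto)
  then show ?thesis
    by (simp add: mean_def field_simps)
qed

lemma avg_objective_mean: "avg_objective f z = mean (\<lambda>i. f i z)"
  by (simp add: avg_objective_def mean_def)

section \<open>Convex functions near a minimizer\<close>

text \<open>
  A convex function is bounded on the slightly larger ball of radius \<open>R + 1\<close>. If it were steep inside,
  then prolonging the steep segment by length one would leave the bound.
\<close>
lemma convex_Lipschitz_on_cball:
  fixes f :: "'a::euclidean_space \<Rightarrow> real"
  assumes convex: "convex_on UNIV f"
  obtains K where "0 \<le> K"
    and "\<And>x y. x \<in> cball z R \<Longrightarrow> y \<in> cball z R \<Longrightarrow> f x - f y \<le> K * norm (x - y)"
proof -
  have "continuous_on (cball z (R + 1)) f"
    using convex_on_continuous[OF open_UNIV convex] continuous_on_subset by blast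
  then have "bounded (f ` cball z (R + 1))"
    using compact_continuous_image compact_imp_bounded compact_cball by blast
  then obtain M where M: "\<And>x. x \<in> cball z (R + 1) \<Longrightarrow> \<bar>f x\<bar> \<le> M"
    unfolding bounded_iff by (metis imageI real_norm_def)
  have "f x - f y \<le> (2 * \<bar>M\<bar>) * norm (x - y)" if x: "x \<in> cball z R" and y: "y \<in> cball z R" for x y
  proof (cases "x = y")
    case False
    define d where "d = norm (x - y)"
    have d: "d > 0" using False by (simp add: d_def)
    \<comment> \<open>Prolong the segment from \<open>y\<close> to \<open>x\<close> by a unit vector; \<open>x\<close> is a convex combination of the ends.\<close>
    define x' where "x' = x + (1 / d) *\<^sub>R (x - y)"
    define l where "l = d / (1 + d)"
    have l: "0 \<le> l" "l \<le> 1" "l \<le> d" using d by (auto simp: l_def field_simps)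
    have "dist z x' \<le> dist z x + dist x x'" by (rule dist_triangle)
    also have "dist x x' = 1" using d by (simp add: x'_def dist_norm d_def)
    finally have x': "x' \<in> cball z (R + 1)" using x by simp
    have "x = (1 - l) *\<^sub>R y + l *\<^sub>R x'"
    proof -
      have "(1 - l) *\<^sub>R y + l *\<^sub>R x' = y + (l + l / d) *\<^sub>R (x - y)"
        by (simp add: x'_def algebra_simps)
      also have "l + l / d = 1"
        using d by (simp add: l_def flip: add_divide_distrib)
      finally show ?thesis by simp
    qed
    then have "f x \<le> (1 - l) * f y + l * f x'"
      using convex_onD[OF convex, of l y x'] l by simp
    then have "f x - f y \<le> l * (f x' - f y)" by (simp add: algebra_simps)
    also have "\<dots> \<le> l * (2 * \<bar>M\<bar>)"
    proof (rule mult_left_mono)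
      have "y \<in> cball z (R + 1)" using y by simp
      then show "f x' - f y \<le> 2 * \<bar>M\<bar>" using M[OF x'] M[of y] by linarith
    qed (use l in auto)
    also have "\<dots> \<le> d * (2 * \<bar>M\<bar>)" using l by (intro mult_right_mono) auto
    finally show ?thesis by (simp add: d_def mult.commute)
  qed simp
  then show ?thesis using that[of "2 * \<bar>M\<bar>"] by auto
qed

lemma convex_family_Lipschitz_on_cball:
  fixes f :: "'n::finite \<Rightarrow> 'a::euclidean_space \<Rightarrow> real"
  assumes convex: "\<And>i. convex_on UNIV (f i)"
  obtains K where "0 \<le> K"
    and "\<And>i x y. x \<in> cball z R \<Longrightarrow> y \<in> cball z R \<Longrightarrow> f i x - f i y \<le> K * norm (x - y)"
proof -
  have "\<exists>K. 0 \<le> K \<and> (\<forall>x\<in>cball z R. \<forall>y\<in>cball z R. f i x - f i y \<le> K * norm (x - y))" for i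
    using convex_Lipschitz_on_cball[OF convex, of z R i] by metis
  then obtain K where K0: "\<And>i. 0 \<le> K i"
    and K: "\<And>i x y. x \<in> cball z R \<Longrightarrow> y \<in> cball z R \<Longrightarrow> f i x - f i y \<le> K i * norm (x - y)"
    by metis
  have "f i x - f i y \<le> (\<Sum>j\<in>UNIV. K j) * norm (x - y)"
    if "x \<in> cball z R" "y \<in> cball z R" for i x y
  proof -
    have "K i \<le> (\<Sum>j\<in>UNIV. K j)" by (rule member_le_sum) (auto simp: K0)
    then show ?thesis using K[OF that, of i] by (smt (verit) mult_right_mono norm_ge_zero)
  qed
  then show ?thesis using that[of "\<Sum>j\<in>UNIV. K j"] by (simp add: K0 sum_nonneg)
qed

text \<open>
  Were all \<open>u i\<close> equal, the left-hand side would be nonpositive. For different points, contract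
  everything towards \<open>zs\<close> until \<open>x\<close> and all \<open>u i\<close> are in the unit ball, where a fixed Lipschitz
  constant compares the values of \<open>f i\<close> at the contracted points. By convexity the contracted
  deficit is at least \<open>l\<close> times the original one; the distances shrink by exactly the factor \<open>l\<close>,
  which therefore cancels, and \<open>K\<close> depends on neither \<open>x\<close> nor \<open>u\<close>.
\<close>
lemma disagreement_bounds_descent_below:
  fixes f :: "'n::finite \<Rightarrow> 'a::euclidean_space \<Rightarrow> real"
  assumes convex: "\<And>i. convex_on UNIV (f i)"
    and minimizer: "\<And>z. avg_objective f zs \<le> avg_objective f z"
  obtains K where "0 \<le> K"
    and "\<And>x u. mean (\<lambda>i. f i zs - f i (u i)) \<le> K * mean (\<lambda>i. norm (u i - x))"
proof -
  obtain K where K0: "0 \<le> K"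
    and K: "\<And>i x y. x \<in> cball zs 1 \<Longrightarrow> y \<in> cball zs 1 \<Longrightarrow> f i x - f i y \<le> K * norm (x - y)"
    using convex_family_Lipschitz_on_cball[where f = f and z = zs and R = 1, OF convex] by metis
  have "mean (\<lambda>i. f i zs - f i (u i)) \<le> K * mean (\<lambda>i. norm (u i - x))" for x u
  proof -
    define N where "N = 1 + norm (x - zs) + (\<Sum>i\<in>UNIV. norm (u i - zs))"
    define l where "l = 1 / N"
    have S0: "0 \<le> (\<Sum>i\<in>UNIV. norm (u i - zs))" by (simp add: sum_nonneg)
    have N: "N \<ge> 1" using S0 unfolding N_def by (smt (verit) norm_ge_zero)
    have l: "0 < l" "l \<le> 1" using N by (auto simp: l_def)
    define h where "h v = zs + l *\<^sub>R (v - zs)" for v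
    have ball: "h v \<in> cball zs 1" if "norm (v - zs) \<le> N" for v
    proof -
      have "dist zs (h v) = l * norm (v - zs)"
        using l by (simp add: h_def dist_norm)
      also have "\<dots> \<le> l * N"
        using that l by (intro mult_left_mono) auto
      also have "\<dots> = 1" using N by (simp add: l_def)
      finally show ?thesis by simp
    qed
    have hu: "h (u i) \<in> cball zs 1" for i
    proof (rule ball)
      have "norm (u i - zs) \<le> (\<Sum>i\<in>UNIV. norm (u i - zs))"
        by (rule member_le_sum) auto
      then show "norm (u i - zs) \<le> N" unfolding N_def by (smt (verit) norm_ge_zero)
    qed
    have hx: "h x \<in> cball zs 1"
      by (rule ball) (use S0 in \<open>simp add: N_def\<close>)
    have "l * (f i zs - f i (u i)) \<le> f i zs - f i (h x) + l * (K * norm (u i - x))" for i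
    proof -
      have "h (u i) = (1 - l) *\<^sub>R zs + l *\<^sub>R u i" by (simp add: h_def algebra_simps)
      then have "f i (h (u i)) \<le> (1 - l) * f i zs + l * f i (u i)"
        using convex_onD[OF convex[of i], of l zs "u i"] l by simp
      moreover have "f i (h x) - f i (h (u i)) \<le> l * (K * norm (u i - x))"
      proof -
        have "h x - h (u i) = l *\<^sub>R (x - u i)" by (simp add: h_def algebra_simps)
        then show ?thesis using K[OF hx hu, of i i] l by (simp add: norm_minus_commute mult_ac)
      qed
      ultimately show ?thesis by (simp add: algebra_simps)
    qed
    then have "mean (\<lambda>i. l *\<^sub>R (f i zs - f i (u i)))
        \<le> mean (\<lambda>i. (f i zs - f i (h x)) - (- (l * K)) *\<^sub>R norm (u i - x))"
      by (intro mean_mono) (simp add: mult.assoc)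
    also have "\<dots> = avg_objective f zs - avg_objective f (h x) + l * K * mean (\<lambda>i. norm (u i - x))"
      unfolding mean_diff mean_scaleR by (simp add: avg_objective_mean)
    also have "\<dots> \<le> l * (K * mean (\<lambda>i. norm (u i - x)))"
      using minimizer[of "h x"] by simp
    finally show ?thesis
      unfolding mean_scaleR using l by simp
  qed
  with K0 that show ?thesis by blast
qed

section \<open>Subgradient descent with disagreement\<close>

text \<open>
  Expand the square. The subgradient inequality holds at \<open>z i\<close>, whereas the cross term contains the
  common point \<open>x\<close>; exchanging one for the other costs \<open>G * \<epsilon>\<close> for each agent.
\<close>
lemma disagreeing_descent_step:
  fixes f :: "'n::finite \<Rightarrow> 'a::real_inner \<Rightarrow> real"
  assumes subgrad: "\<And>i. is_subgradient (f i) (z i) (g i)"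
    and g: "\<And>i. norm (g i) \<le> G"
    and close: "\<And>i. norm (z i - x) \<le> \<epsilon>"
    and a: "0 \<le> a"
  shows "(norm (x - a *\<^sub>R mean g - v))\<^sup>2
      \<le> (norm (x - v))\<^sup>2 + 2 * a * (mean (\<lambda>i. f i v - f i (z i)) + G * \<epsilon>) + a\<^sup>2 * G\<^sup>2"
proof -
  have "- (g i \<bullet> (x - v)) \<le> (f i v - f i (z i)) + G * \<epsilon>" for i
  proof -
    have "f i v \<ge> f i (z i) + g i \<bullet> (v - z i)"
      using subgrad[of i] unfolding is_subgradient_def by blast
    moreover have "g i \<bullet> (z i - x) \<le> G * \<epsilon>"
    proof -
      have "g i \<bullet> (z i - x) \<le> norm (g i) * norm (z i - x)" by (rule norm_cauchy_schwarz)
      also have "\<dots> \<le> G * \<epsilon>"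
        using order_trans[OF norm_ge_zero g[of i]] by (intro mult_mono g close) auto
      finally show ?thesis .
    qed
    ultimately show ?thesis by (simp add: inner_diff_right)
  qed
  then have "mean (\<lambda>i. (-1) *\<^sub>R (g i \<bullet> (x - v))) \<le> mean (\<lambda>i. (f i v - f i (z i)) - (- (G * \<epsilon>)))"
    by (intro mean_mono) simp
  then have *: "- (mean g \<bullet> (x - v)) \<le> mean (\<lambda>i. f i v - f i (z i)) + G * \<epsilon>"
    unfolding mean_scaleR mean_diff[of _ "\<lambda>i. - (G * \<epsilon>)"] mean_const by (simp add: mean_inner)
  have "(norm (x - a *\<^sub>R mean g - v))\<^sup>2
      = (norm (x - v))\<^sup>2 + 2 * a * (- (mean g \<bullet> (x - v))) + a\<^sup>2 * (norm (mean g))\<^sup>2"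
    unfolding power2_norm_eq_inner
    by (simp add: algebra_simps inner_diff_left inner_diff_right inner_commute power2_eq_square)
  moreover have "2 * a * (- (mean g \<bullet> (x - v))) \<le> 2 * a * (mean (\<lambda>i. f i v - f i (z i)) + G * \<epsilon>)"
    using * a by (intro mult_left_mono) auto
  moreover have "a\<^sup>2 * (norm (mean g))\<^sup>2 \<le> a\<^sup>2 * G\<^sup>2"
    using norm_mean_le[of g G] g by (intro mult_left_mono power_mono) auto
  ultimately show ?thesis by linarith
qed

text \<open>
  The index \<open>r\<close> ranges over runs with different horizons, stepsizes and subgradients; the point is that
  one \<open>C\<close> serves all of them. The step estimate is summed twice. The first time, with
  \<open>disagreement_bounds_descent_below\<close>, it confines the common points to a ball of radius \<open>sqrt \<rho>\<close>
  around \<open>zs\<close>. This provides a Lipschitz constant \<open>K'\<close> valid at all points that occur, with which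
  the second summation yields the gap at the averages.
\<close>
theorem disagreeing_descent_weighted_gap:
  fixes f :: "'n::finite \<Rightarrow> 'a::euclidean_space \<Rightarrow> real"
    and T :: "'r \<Rightarrow> nat" and \<alpha> :: "'r \<Rightarrow> nat \<Rightarrow> real" and \<epsilon> :: "'r \<Rightarrow> nat \<Rightarrow> real"
    and g z :: "'r \<Rightarrow> nat \<Rightarrow> 'n \<Rightarrow> 'a" and x :: "'r \<Rightarrow> nat \<Rightarrow> 'a"
  assumes convex: "\<And>i. convex_on UNIV (f i)"
    and minimizer: "\<And>z. avg_objective f zs \<le> avg_objective f z"
    and subgrad: "\<And>r t i. r \<in> I \<Longrightarrow> t < T r \<Longrightarrow> is_subgradient (f i) (z r t i) (g r t i)"
    and g: "\<And>r t i. r \<in> I \<Longrightarrow> t < T r \<Longrightarrow> norm (g r t i) \<le> G"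
    and \<alpha>: "\<And>r t. r \<in> I \<Longrightarrow> t < T r \<Longrightarrow> 0 \<le> \<alpha> r t"
    and x_0: "\<And>r. r \<in> I \<Longrightarrow> x r 0 = b"
    and x_Suc: "\<And>r t. r \<in> I \<Longrightarrow> t < T r \<Longrightarrow> x r (Suc t) = x r t - \<alpha> r t *\<^sub>R mean (g r t)"
    and close: "\<And>r t i. r \<in> I \<Longrightarrow> t < T r \<Longrightarrow> norm (z r t i - x r t) \<le> \<epsilon> r t"
    and D: "\<And>r t. r \<in> I \<Longrightarrow> t < T r \<Longrightarrow> \<epsilon> r t \<le> D"
    and Q: "\<And>r. r \<in> I \<Longrightarrow> (\<Sum>t<T r. \<alpha> r t * \<epsilon> r t) \<le> Q"
    and A: "\<And>r. r \<in> I \<Longrightarrow> (\<Sum>t<T r. (\<alpha> r t)\<^sup>2) \<le> A"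
  obtains C where "\<And>r. r \<in> I \<Longrightarrow>
      (\<Sum>t<T r. \<alpha> r t * (avg_objective f (mean (z r t)) - avg_objective f zs)) \<le> C"
proof -
  obtain K where K0: "0 \<le> K"
    and K: "\<And>x u. mean (\<lambda>i. f i zs - f i (u i)) \<le> K * mean (\<lambda>i. norm (u i - x))"
    using disagreement_bounds_descent_below[of f zs, OF convex minimizer] by metis
  define \<rho> where "\<rho> = (norm (b - zs))\<^sup>2 + 2 * (K + \<bar>G\<bar>) * Q + A * G\<^sup>2"
  obtain K' where K'0: "0 \<le> K'"
    and K': "\<And>i x y. x \<in> cball zs (sqrt \<rho> + D) \<Longrightarrow> y \<in> cball zs (sqrt \<rho> + D)
              \<Longrightarrow> f i x - f i y \<le> K' * norm (x - y)"
    using convex_family_Lipschitz_on_cball[where f = f and z = zs and R = "sqrt \<rho> + D", OF convex] by metis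
  define C where "C = ((norm (b - zs))\<^sup>2 + 2 * (2 * K' + \<bar>G\<bar>) * Q + A * G\<^sup>2) / 2"
  show ?thesis
  proof (rule that[of C])
    fix r assume r: "r \<in> I"
    let ?T = "T r" and ?\<alpha> = "\<alpha> r" and ?\<epsilon> = "\<epsilon> r" and ?g = "g r" and ?z = "z r" and ?x = "x r"
    note subgrad = subgrad[OF r] and g = g[OF r] and \<alpha> = \<alpha>[OF r] and x_0 = x_0[OF r]
      and x_Suc = x_Suc[OF r] and close = close[OF r] and D = D[OF r] and Q = Q[OF r] and A = A[OF r]
    have \<epsilon>0: "0 \<le> ?\<epsilon> t" if "t < ?T" for t
      using close[OF that] norm_ge_zero order_trans by blast
    have step: "(norm (?x (Suc t) - zs))\<^sup>2 \<le> (norm (?x t - zs))\<^sup>2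
        + 2 * ?\<alpha> t * (mean (\<lambda>i. f i zs - f i (?z t i)) + \<bar>G\<bar> * ?\<epsilon> t) + (?\<alpha> t)\<^sup>2 * G\<^sup>2" if "t < ?T" for t
    proof -
      have gG: "norm (?g t i) \<le> \<bar>G\<bar>" for i using g[OF that, of i] by linarith
      show ?thesis unfolding x_Suc[OF that]
        using disagreeing_descent_step[of f "?z t" "?g t" "\<bar>G\<bar>" "?x t" "?\<epsilon> t" "?\<alpha> t" zs,
            OF subgrad[OF that] gG close[OF that] \<alpha>[OF that]] by simp
    qed
    \<comment> \<open>Used for both summations: with \<open>F = 0\<close> to confine the iterates, then with the gap itself as \<open>F\<close>.\<close>
    have accumulate: "(norm (?x m - zs))\<^sup>2 + (\<Sum>t<m. 2 * ?\<alpha> t * F t)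
        \<le> (norm (b - zs))\<^sup>2 + 2 * (c + \<bar>G\<bar>) * Q + A * G\<^sup>2"
      if F: "\<And>t. t < m \<Longrightarrow> mean (\<lambda>i. f i zs - f i (?z t i)) \<le> c * ?\<epsilon> t - F t"
        and m: "m \<le> ?T" and c: "0 \<le> c" for m F c
    proof -
      have "(norm (?x m - zs))\<^sup>2 + (\<Sum>t<m. 2 * ?\<alpha> t * F t)
          \<le> (norm (b - zs))\<^sup>2 + (\<Sum>t<m. 2 * (c + \<bar>G\<bar>) * (?\<alpha> t * ?\<epsilon> t) + (?\<alpha> t)\<^sup>2 * G\<^sup>2)"
        using F m
      proof (induction m)
        case (Suc m)
        then have IH: "(norm (?x m - zs))\<^sup>2 + (\<Sum>t<m. 2 * ?\<alpha> t * F t)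
          \<le> (norm (b - zs))\<^sup>2 + (\<Sum>t<m. 2 * (c + \<bar>G\<bar>) * (?\<alpha> t * ?\<epsilon> t) + (?\<alpha> t)\<^sup>2 * G\<^sup>2)"
          and m: "m < ?T" by auto
        have "2 * ?\<alpha> m * (mean (\<lambda>i. f i zs - f i (?z m i)) + \<bar>G\<bar> * ?\<epsilon> m)
            \<le> 2 * ?\<alpha> m * (c * ?\<epsilon> m - F m + \<bar>G\<bar> * ?\<epsilon> m)"
          using \<alpha>[OF m] Suc.prems(1)[of m] by (intro mult_left_mono) auto
        also have "\<dots> = 2 * (c + \<bar>G\<bar>) * (?\<alpha> m * ?\<epsilon> m) - 2 * ?\<alpha> m * F m"
          by (simp add: algebra_simps)
        finally show ?case using step[OF m] IH unfolding sum.lessThan_Suc by linarith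
      qed (simp add: x_0)
      also have "(\<Sum>t<m. 2 * (c + \<bar>G\<bar>) * (?\<alpha> t * ?\<epsilon> t) + (?\<alpha> t)\<^sup>2 * G\<^sup>2)
          \<le> (\<Sum>t<?T. 2 * (c + \<bar>G\<bar>) * (?\<alpha> t * ?\<epsilon> t) + (?\<alpha> t)\<^sup>2 * G\<^sup>2)"
        using m c \<alpha> \<epsilon>0 by (intro sum_mono2) auto
      also have "\<dots> = 2 * (c + \<bar>G\<bar>) * (\<Sum>t<?T. ?\<alpha> t * ?\<epsilon> t) + (\<Sum>t<?T. (?\<alpha> t)\<^sup>2) * G\<^sup>2"
        by (simp add: sum.distrib sum_distrib_left sum_distrib_right)
      also have "\<dots> \<le> 2 * (c + \<bar>G\<bar>) * Q + A * G\<^sup>2"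
        using Q A c by (intro add_mono mult_left_mono mult_right_mono) auto
      finally show ?thesis by simp
    qed
    have "mean (\<lambda>i. f i zs - f i (?z t i)) \<le> K * ?\<epsilon> t - 0" if "t < ?T" for t
    proof -
      have "mean (\<lambda>i. norm (?z t i - ?x t)) \<le> mean (\<lambda>i::'n. ?\<epsilon> t)"
        by (intro mean_mono close that)
      then have "K * mean (\<lambda>i. norm (?z t i - ?x t)) \<le> K * ?\<epsilon> t"
        using K0 by (simp add: mult_left_mono)
      then show ?thesis
        using K[of "?z t" "?x t"] by simp
    qed
    then have "(norm (?x t - zs))\<^sup>2 \<le> \<rho>" if "t < ?T" for t
      using accumulate[of t K "\<lambda>_. 0"] that K0 unfolding \<rho>_def by simp
    then have x_ball: "norm (?x t - zs) \<le> sqrt \<rho>" if "t < ?T" for t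
      using that real_le_rsqrt by blast
    have "mean (\<lambda>i. f i zs - f i (?z t i))
        \<le> (2 * K') * ?\<epsilon> t - (avg_objective f (mean (?z t)) - avg_objective f zs)" if t: "t < ?T" for t
    proof -
      have "norm (mean (\<lambda>i. ?z t i - ?x t)) \<le> ?\<epsilon> t"
        by (intro norm_mean_le close t)
      then have mean_close: "norm (mean (?z t) - ?x t) \<le> ?\<epsilon> t"
        by (simp add: mean_diff)
      have in_ball: "v \<in> cball zs (sqrt \<rho> + D)" if "norm (v - ?x t) \<le> ?\<epsilon> t" for v
        using that D[OF t] x_ball[OF t] norm_triangle_ineq[of "v - ?x t" "?x t - zs"]
        by (simp add: dist_norm norm_minus_commute)
      have "f i zs - f i (?z t i) \<le> (2 * K' * ?\<epsilon> t) - (f i (mean (?z t)) - f i zs)" for i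
      proof -
        have "f i (mean (?z t)) - f i (?z t i) \<le> K' * norm (mean (?z t) - ?z t i)"
          using in_ball mean_close close[OF t] by (intro K') auto
        also have "\<dots> \<le> K' * (2 * ?\<epsilon> t)"
        proof (rule mult_left_mono[OF _ K'0])
          have "norm ((mean (?z t) - ?x t) - (?z t i - ?x t)) \<le> norm (mean (?z t) - ?x t) + norm (?z t i - ?x t)"
            by (rule norm_triangle_ineq4)
          then show "norm (mean (?z t) - ?z t i) \<le> 2 * ?\<epsilon> t"
            using mean_close close[OF t, of i] by simp
        qed
        finally show ?thesis by simp
      qed
      then have "mean (\<lambda>i. f i zs - f i (?z t i))
          \<le> mean (\<lambda>i. (2 * K' * ?\<epsilon> t) - (f i (mean (?z t)) - f i zs))"
        by (rule mean_mono)
      also have "\<dots> = 2 * K' * ?\<epsilon> t - (avg_objective f (mean (?z t)) - avg_objective f zs)"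
        by (simp only: mean_diff mean_const avg_objective_mean)
      finally show ?thesis .
    qed
    then have "(norm (?x ?T - zs))\<^sup>2
        + (\<Sum>t<?T. 2 * ?\<alpha> t * (avg_objective f (mean (?z t)) - avg_objective f zs))
        \<le> 2 * C"
      using K'0 accumulate[of ?T "2 * K'"
          "\<lambda>t. avg_objective f (mean (?z t)) - avg_objective f zs"]
      by (simp add: C_def)
    moreover have "(\<Sum>t<?T. 2 * ?\<alpha> t * (avg_objective f (mean (?z t)) - avg_objective f zs))
        = 2 * (\<Sum>t<?T. ?\<alpha> t * (avg_objective f (mean (?z t)) - avg_objective f zs))"
      by (simp add: sum_distrib_left mult.assoc)
    ultimately show "(\<Sum>t<?T. ?\<alpha> t * (avg_objective f (mean (?z t)) - avg_objective f zs)) \<le> C"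
      using zero_le_power2[of "norm (?x ?T - zs)"] by linarith
  qed
qed

section \<open>Averaging along a uniformly strongly connected graph sequence\<close>

lemma strongly_connected_crossing_arc:
  assumes "strongly_connected (with_proj (union_graph E I))"
    and "a \<in> S" "b \<notin> S"
  shows "\<exists>k\<in>I. \<exists>j\<in>S. \<exists>i. i \<notin> S \<and> (j, i) \<in> E k"
proof -
  have "(a, b) \<in> rtrancl_on UNIV (\<Union>k\<in>I. E k)"
    using assms(1) by (simp add: strongly_connected_def reachable_def union_graph_def)
  then show ?thesis
    using assms(2,3) by (induction rule: rtrancl_on_induct) blast+
qed

lemma maximum_attained:
  fixes v :: "'n::finite \<Rightarrow> real"
  shows "\<exists>a. \<forall>i. v i \<le> v a"
proof -
  have "Max (range v) \<in> range v" by (rule Max_in) auto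
  moreover have "v i \<le> Max (range v)" for i by (rule Max_ge) auto
  ultimately show ?thesis by (metis imageE)
qed

text \<open>
  The agents \<open>i\<close> with \<open>p ^ m * c \<le> u m i\<close> form a set that never loses a member, thanks to the
  self-arcs. As long as it is not everything, some arc within each window of length \<open>L\<close> leaves it and
  adds a new member, so after \<open>CARD('n)\<close> windows it is full.
\<close>
lemma positivity_spreads:
  fixes E :: "nat \<Rightarrow> ('n::finite \<times> 'n) set" and M :: "nat \<Rightarrow> 'n \<Rightarrow> 'n \<Rightarrow> real"
  assumes self_arc: "\<And>t i. (i, i) \<in> E t"
    and connected: "\<And>t. strongly_connected (with_proj (union_graph E {t..<t + L}))"
    and M_nonneg: "\<And>t i j. 0 \<le> M t i j"
    and M_arc: "\<And>t i j. (j, i) \<in> E t \<Longrightarrow> p \<le> M t i j"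
    and p: "0 < p" "p \<le> 1"
    and u_Suc: "\<And>m i. u (Suc m) i = (\<Sum>j\<in>UNIV. M (s + m) i j * u m j)"
    and u_nonneg: "\<And>i. 0 \<le> u 0 i"
    and c: "0 \<le> c" "c \<le> u 0 k"
  shows "p ^ (CARD('n) * L) * c \<le> u (CARD('n) * L) i"
proof -
  have u0: "0 \<le> u m i" for m i
    by (induction m arbitrary: i) (simp_all add: u_nonneg u_Suc sum_nonneg M_nonneg)
  define S where "S m = {i. p ^ m * c \<le> u m i}" for m
  have S_arc: "i \<in> S (Suc m)" if "j \<in> S m" "(j, i) \<in> E (s + m)" for i j m
  proof -
    have "p ^ Suc m * c \<le> M (s + m) i j * u m j"
      using that M_arc[of j i "s + m"] p c u0[of m j] M_nonneg unfolding S_def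
      by (simp add: mult.assoc mult_mono)
    also have "\<dots> \<le> u (Suc m) i"
      unfolding u_Suc by (rule member_le_sum) (simp_all add: M_nonneg u0)
    finally show ?thesis by (simp add: S_def)
  qed
  have S_mono: "S m \<subseteq> S (m + r)" for m r
    by (induction r) (use S_arc self_arc in auto)
  have "min (Suc q) CARD('n) \<le> card (S (q * L))" for q
  proof (induction q)
    case 0
    have "k \<in> S 0" using c by (simp add: S_def)
    then have "0 < card (S 0)" by (auto simp: card_gt_0_iff)
    then show ?case by simp
  next
    case (Suc q)
    have sub: "S (q * L) \<subseteq> S (Suc q * L)"
      using S_mono[of "q * L" L] by (simp add: add.commute)
    show ?case
    proof (cases "S (q * L) = UNIV")
      case True
      then have "S (Suc q * L) = UNIV" using sub by auto
      then show ?thesis by simp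
    next
      case False
      have "S (q * L) \<noteq> {}"
      proof
        assume "S (q * L) = {}"
        then show False using Suc.IH by (simp add: min_def split: if_splits)
      qed
      then obtain a b where "a \<in> S (q * L)" "b \<notin> S (q * L)" using False by blast
      from strongly_connected_crossing_arc[OF connected[of "s + q * L"] this]
      obtain k' j i where k': "k' \<in> {s + q * L..<s + q * L + L}"
        and ji: "j \<in> S (q * L)" "i \<notin> S (q * L)" "(j, i) \<in> E k'" by blast
      define r where "r = k' - (s + q * L)"
      have r: "k' = s + (q * L + r)" "r < L" using k' by (auto simp: r_def)
      have "j \<in> S (q * L + r)" using S_mono ji by blast
      then have "i \<in> S (Suc (q * L + r))" using S_arc ji r by simp
      moreover have "S (Suc (q * L + r)) \<subseteq> S (Suc q * L)"
        using S_mono[of "Suc (q * L + r)" "L - Suc r"] r by (simp add: algebra_simps)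
      ultimately have "S (q * L) \<subset> S (Suc q * L)" using ji sub by blast
      then have "card (S (q * L)) < card (S (Suc q * L))"
        by (intro psubset_card_mono) auto
      then show ?thesis using Suc.IH by linarith
    qed
  qed
  from this[of "CARD('n)"] have "card (S (CARD('n) * L)) = CARD('n)"
    by (metis antisym card_mono finite_class.finite_UNIV le_Suc_eq min_def not_less_eq_eq subset_UNIV)
  then have "S (CARD('n) * L) = UNIV"
    by (simp add: card_eq_UNIV_imp_eq_UNIV)
  then show ?thesis unfolding S_def by blast
qed

text \<open>
  Subtracting a constant from \<open>u\<close> or reflecting it preserves the recursion, because the row sums are
  one. So positivity can spread the distance of the minimal entry from the maximum to all agents:
  after one block everybody is below the old maximum by a fixed fraction of the old range.
\<close>
lemma averaging_contracts_block:
  fixes E :: "nat \<Rightarrow> ('n::finite \<times> 'n) set" and M :: "nat \<Rightarrow> 'n \<Rightarrow> 'n \<Rightarrow> real"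
  assumes self_arc: "\<And>t i. (i, i) \<in> E t"
    and connected: "\<And>t. strongly_connected (with_proj (union_graph E {t..<t + L}))"
    and M_nonneg: "\<And>t i j. 0 \<le> M t i j"
    and M_arc: "\<And>t i j. (j, i) \<in> E t \<Longrightarrow> p \<le> M t i j"
    and p: "0 < p" "p \<le> 1"
    and M_row: "\<And>t i. (\<Sum>j\<in>UNIV. M t i j) = 1"
    and u_Suc: "\<And>m i. u (Suc m) i = (\<Sum>j\<in>UNIV. M (s + m) i j * u m j)"
    and D: "\<And>i j. u 0 i - u 0 j \<le> D"
  shows "u (CARD('n) * L) i - u (CARD('n) * L) j \<le> (1 - p ^ (CARD('n) * L)) * D"
proof -
  let ?B = "CARD('n) * L" and ?\<delta> = "p ^ (CARD('n) * L)"
  obtain a where a: "\<And>j. u 0 j \<le> u 0 a" using maximum_attained[of "u 0"] by blast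
  obtain b where b: "\<And>j. - u 0 j \<le> - u 0 b" using maximum_attained[of "\<lambda>j. - u 0 j"] by blast
  have "?\<delta> * (u 0 a - u 0 b) \<le> u 0 a - u ?B i"
  proof (rule positivity_spreads[where E = E and M = M and s = s and k = b
        and u = "\<lambda>m i. u 0 a - u m i", OF self_arc connected M_nonneg M_arc p])
    show "u 0 a - u (Suc m) i = (\<Sum>j\<in>UNIV. M (s + m) i j * (u 0 a - u m j))" for m i
      by (simp add: u_Suc right_diff_distrib sum_subtractf M_row flip: sum_distrib_right)
  qed (use a in auto)
  moreover have "?\<delta> * 0 \<le> u ?B j - u 0 b"
  proof (rule positivity_spreads[where E = E and M = M and s = s and k = b
        and u = "\<lambda>m i. u m i - u 0 b", OF self_arc connected M_nonneg M_arc p])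
    show "u (Suc m) i - u 0 b = (\<Sum>j\<in>UNIV. M (s + m) i j * (u m j - u 0 b))" for m i
      by (simp add: u_Suc right_diff_distrib sum_subtractf M_row flip: sum_distrib_right)
  qed (use b in auto)
  ultimately have "u ?B i - u ?B j \<le> (1 - ?\<delta>) * (u 0 a - u 0 b)"
    by (simp add: algebra_simps)
  also have "\<dots> \<le> (1 - ?\<delta>) * D"
    using D[of a b] p by (intro mult_left_mono) (auto simp: power_le_one)
  finally show ?thesis .
qed

theorem averaging_contracts:
  fixes E :: "nat \<Rightarrow> ('n::finite \<times> 'n) set" and M :: "nat \<Rightarrow> 'n \<Rightarrow> 'n \<Rightarrow> real"
  assumes self_arc: "\<And>t i. (i, i) \<in> E t"
    and connected: "\<And>t. strongly_connected (with_proj (union_graph E {t..<t + L}))"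
    and L: "0 < L"
    and M_nonneg: "\<And>t i j. 0 \<le> M t i j"
    and M_arc: "\<And>t i j. (j, i) \<in> E t \<Longrightarrow> p \<le> M t i j"
    and p: "0 < p" "p \<le> 1"
    and M_row: "\<And>t i. (\<Sum>j\<in>UNIV. M t i j) = 1"
    and u_Suc: "\<And>m i. u (Suc m) i = (\<Sum>j\<in>UNIV. M (s + m) i j * u m j)"
    and D: "\<And>i j. u 0 i - u 0 j \<le> D"
  shows "u m i - u m j \<le> (1 - p ^ (CARD('n) * L)) ^ (m div (CARD('n) * L)) * D"
proof -
  let ?B = "CARD('n) * L" and ?\<delta> = "p ^ (CARD('n) * L)"
  have block: "u (q * ?B) i - u (q * ?B) j \<le> (1 - ?\<delta>) ^ q * D" for q i j
  proof (induction q arbitrary: i j)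
    case (Suc q)
    have "u (q * ?B + ?B) i - u (q * ?B + ?B) j \<le> (1 - ?\<delta>) * ((1 - ?\<delta>) ^ q * D)"
      by (rule averaging_contracts_block[where E = E and M = M and s = "s + q * ?B"
            and u = "\<lambda>m. u (q * ?B + m)", OF self_arc connected M_nonneg M_arc p M_row])
        (simp_all add: u_Suc Suc.IH add.assoc)
    then show ?case by (simp add: add.commute mult.assoc)
  qed (use D in simp)
  \<comment> \<open>For the steps after the last complete block it is enough that averaging does not enlarge the range.\<close>
  have no_growth: "u (q + r) i - u (q + r) j \<le> c" if "\<And>i j. u q i - u q j \<le> c" for q r c i j
  proof (induction r arbitrary: i j)
    case (Suc r)
    obtain a where a: "\<And>j. u (q + r) j \<le> u (q + r) a" using maximum_attained[of "u (q + r)"] by blast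
    obtain b where b: "\<And>j. - u (q + r) j \<le> - u (q + r) b"
      using maximum_attained[of "\<lambda>j. - u (q + r) j"] by blast
    have "u (q + Suc r) i \<le> (\<Sum>j\<in>UNIV. M (s + (q + r)) i j * u (q + r) a)"
      unfolding add_Suc_right u_Suc by (intro sum_mono mult_left_mono a M_nonneg)
    moreover have "(\<Sum>k\<in>UNIV. M (s + (q + r)) j k * u (q + r) b) \<le> u (q + Suc r) j"
      unfolding add_Suc_right u_Suc using b by (intro sum_mono mult_left_mono M_nonneg) auto
    ultimately have "u (q + Suc r) i - u (q + Suc r) j \<le> u (q + r) a - u (q + r) b"
      by (simp add: M_row flip: sum_distrib_right)
    then show ?case using Suc.IH[of a b] by simp
  qed (use that in simp)
  show ?thesis
    using no_growth[where q = "m div ?B * ?B" and r = "m mod ?B", OF block]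
    by (simp only: div_mult_mod_eq)
qed

lemma summable_power_div:
  fixes c :: real
  assumes "0 \<le> c" "c < 1" "0 < B"
  shows "summable (\<lambda>m. c ^ (m div B))"
proof (rule summableI_nonneg_bounded)
  fix n
  have "(\<Sum>m<n. c ^ (m div B)) \<le> (\<Sum>m<n * B. c ^ (m div B))"
    using assms by (intro sum_mono2) auto
  also have "\<dots> = (\<Sum>q<n. \<Sum>m=q * B..<q * B + B. c ^ (m div B))"
    by (simp add: sum.nat_group)
  also have "\<dots> = (\<Sum>q<n. \<Sum>m=q * B..<q * B + B. c ^ q)"
  proof (intro sum.cong refl)
    fix q m assume "m \<in> {q * B..<q * B + B}"
    then have "m div B = q"
      by (intro div_nat_eqI) (auto simp: algebra_simps)
    then show "c ^ (m div B) = c ^ q" by simp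
  qed
  also have "\<dots> = real B * (\<Sum>q<n. c ^ q)" by (simp add: sum_distrib_left)
  also have "\<dots> \<le> real B * (\<Sum>q. c ^ q)"
    using assms by (intro mult_left_mono sum_le_suminf summable_geometric) auto
  finally show "(\<Sum>m<n. c ^ (m div B)) \<le> real B * (\<Sum>q. c ^ q)" .
qed (use assms in simp)

section \<open>The push-sum weights\<close>

locale push_network =
  fixes E :: "nat \<Rightarrow> ('n::finite \<times> 'n) set" and w :: "nat \<Rightarrow> 'n \<Rightarrow> 'n \<Rightarrow> real"
    and L :: nat and \<beta> :: real
  assumes self_arc: "(i, i) \<in> E t"
    and connected: "strongly_connected (with_proj (union_graph E {t..<t + L}))"
    and L: "0 < L"
    and \<beta>: "0 < \<beta>"
    and w_arc: "(j, i) \<in> E t \<Longrightarrow> \<beta> \<le> w t i j"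
    and w_no_arc: "(j, i) \<notin> E t \<Longrightarrow> w t i j = 0"
    and w_column: "(\<Sum>i\<in>UNIV. w t i j) = 1"
begin

abbreviation y where "y \<equiv> push_y E w"

text \<open>
  \<open>\<eta>\<close> bounds \<open>y\<close> from below, so \<open>\<beta> * \<eta> / n\<close> bounds the weights \<open>w t i j * y t j / y (t+1) i\<close>
  of the ratio recursion on arcs; over a block this leads to the factor \<open>contraction\<close>. The
  denominator \<open>\<eta>\<close> in \<open>rate\<close> accounts for the range of the ratios \<open>v i / y t i\<close> when \<open>v\<close> is a unit
  vector.
\<close>
definition block :: nat where "block = CARD('n) * L"
definition \<eta> :: real where "\<eta> = \<beta> ^ block"
definition contraction :: real where "contraction = 1 - (\<beta> * \<eta> / real CARD('n)) ^ block"
definition rate :: "nat \<Rightarrow> real" where "rate m = contraction ^ (m div block) / \<eta>"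

lemma w_nonneg: "0 \<le> w t i j"
  using w_arc[of j i t] w_no_arc[of j i t] \<beta> by fastforce

lemma \<beta>_le_1: "\<beta> \<le> 1"
proof -
  have "w t i i \<le> (\<Sum>k\<in>UNIV. w t k i)" for t i
    by (rule member_le_sum) (auto simp: w_nonneg)
  then show ?thesis using w_arc[OF self_arc] w_column order_trans by metis
qed

lemma sum_in_nbrs:
  fixes v :: "'n \<Rightarrow> 'a::real_vector"
  shows "(\<Sum>j\<in>in_nbrs E t i. w t i j *\<^sub>R v j) = (\<Sum>j\<in>UNIV. w t i j *\<^sub>R v j)"
  by (rule sum.mono_neutral_left) (auto simp: in_nbrs_def w_no_arc)

lemma y_Suc: "y (Suc t) i = (\<Sum>j\<in>UNIV. w t i j * y t j)"
  using sum_in_nbrs[where v = "y t"] by simp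

lemma mass_preserved:
  fixes v :: "'n \<Rightarrow> 'a::real_vector"
  shows "(\<Sum>i\<in>UNIV. \<Sum>j\<in>UNIV. w t i j *\<^sub>R v j) = (\<Sum>j\<in>UNIV. v j)"
proof -
  have "(\<Sum>i\<in>UNIV. \<Sum>j\<in>UNIV. w t i j *\<^sub>R v j) = (\<Sum>j\<in>UNIV. \<Sum>i\<in>UNIV. w t i j *\<^sub>R v j)"
    by (rule sum.swap)
  then show ?thesis by (simp add: w_column flip: scaleR_sum_left)
qed

lemma y_sum: "(\<Sum>i\<in>UNIV. y t i) = real CARD('n)"
proof (induction t)
  case (Suc t)
  then show ?case unfolding y_Suc using mass_preserved[where v = "y t" and t = t] by simp
qed simp

lemma y_nonneg: "0 \<le> y t i"
  by (induction t arbitrary: i) (simp, simp add: y_Suc sum_nonneg w_nonneg del: push_y.simps(2))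

lemma y_le: "y t i \<le> real CARD('n)"
  using member_le_sum[of i UNIV "y t"] by (simp add: y_nonneg y_sum)

lemma \<eta>_pos: "0 < \<eta>" and \<eta>_le_1: "\<eta> \<le> 1"
  using \<beta> \<beta>_le_1 by (simp_all add: \<eta>_def power_le_one)

text \<open>
  The total of \<open>y\<close> is the number of agents, so at every time some agent holds at least one, and a
  block later everybody has received at least \<open>\<beta> ^ block\<close> of it. In the first block the self-arcs alone
  keep this much of the initial value one.
\<close>
lemma y_ge: "\<eta> \<le> y t i"
proof (cases "t < block")
  case True
  have "\<beta> ^ t \<le> y t i" for t i
  proof (induction t arbitrary: i)
    case (Suc t)
    have "\<beta> * \<beta> ^ t \<le> w t i i * y t i"
      using \<beta> Suc w_arc[OF self_arc] by (intro mult_mono) (auto simp: w_nonneg)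
    also have "\<dots> \<le> y (Suc t) i"
      unfolding y_Suc by (rule member_le_sum) (auto simp: w_nonneg y_nonneg)
    finally show ?case by simp
  qed simp
  moreover have "\<eta> \<le> \<beta> ^ t"
    unfolding \<eta>_def using True \<beta> \<beta>_le_1 by (intro power_decreasing) auto
  ultimately show ?thesis using order_trans by blast
next
  case False
  define s where "s = t - block"
  have t: "t = s + block" using False by (simp add: s_def)
  have "\<exists>k. 1 \<le> y s k"
  proof (rule ccontr)
    assume "\<not> ?thesis"
    then have "(\<Sum>k\<in>UNIV. y s k) < (\<Sum>k\<in>(UNIV::'n set). 1)"
      by (intro sum_strict_mono) (auto simp: not_le)
    then show False by (simp add: y_sum)
  qed
  then obtain k where k: "1 \<le> y s k" by blast
  have "\<beta> ^ (CARD('n) * L) * 1 \<le> y (s + CARD('n) * L) i"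
    by (rule positivity_spreads[where E = E and M = w and s = s and k = k
          and u = "\<lambda>m. y (s + m)", OF self_arc connected w_nonneg w_arc \<beta> \<beta>_le_1])
      (use k in \<open>simp_all add: y_Suc y_nonneg del: push_y.simps(2)\<close>)
  then show ?thesis by (simp add: t \<eta>_def block_def)
qed

lemma y_pos: "0 < y t i"
  using \<eta>_pos y_ge less_le_trans by blast

lemma block_pos: "0 < block"
  using L by (simp add: block_def)

lemma arc_bound_pos: "0 < \<beta> * \<eta> / real CARD('n)"
  using \<beta> \<eta>_pos by simp

lemma arc_bound_le_1: "\<beta> * \<eta> / real CARD('n) \<le> 1"
proof -
  have "\<beta> * \<eta> \<le> 1"
    using \<beta> \<beta>_le_1 \<eta>_pos \<eta>_le_1 by (simp add: mult_le_one)
  also have "1 \<le> real CARD('n)" by (simp add: Suc_leI)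
  finally show ?thesis by simp
qed

lemma contraction: "0 \<le> contraction" "contraction < 1"
  using arc_bound_pos arc_bound_le_1
  by (auto simp: contraction_def power_le_one)

lemma rate_nonneg: "0 \<le> rate m"
  using contraction \<eta>_pos by (simp add: rate_def)

lemma rate_summable: "summable rate"
  unfolding rate_def
  by (intro summable_divide summable_power_div contraction block_pos)

text \<open>
  \<open>transition s m k i\<close> is the entry in row \<open>i\<close> and column \<open>k\<close> of the product
  \<open>W(s+m-1) \<dots> W(s)\<close>: the share of a unit mass at \<open>k\<close> that has arrived at \<open>i\<close> after \<open>m\<close> steps from time \<open>s\<close>.
\<close>
primrec transition :: "nat \<Rightarrow> nat \<Rightarrow> 'n \<Rightarrow> 'n \<Rightarrow> real" where
  "transition s 0 k = (\<lambda>i. if i = k then 1 else 0)"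
| "transition s (Suc m) k = (\<lambda>i. \<Sum>j\<in>UNIV. w (s + m) i j * transition s m k j)"

lemma transition_sum: "(\<Sum>i\<in>UNIV. transition s m k i) = 1"
proof (induction m)
  case (Suc m)
  then show ?case using mass_preserved[where v = "transition s m k" and t = "s + m"] by simp
qed simp

text \<open>
  The ratios \<open>u\<close> of the transported mass to \<open>y\<close> evolve by the row-stochastic matrices \<open>M\<close>, so their
  range decays like \<open>rate\<close>. The limit value is found by conservation: the mean of \<open>u\<close> weighted by
  \<open>y\<close> is always \<open>1 / n\<close>, hence \<open>1 / n\<close> lies within the range.
\<close>
theorem transition_mixes:
  "\<bar>transition s m k i / y (s + m) i - 1 / real CARD('n)\<bar> \<le> rate m"
proof -
  define M where "M t i j = w t i j * y t j / y (Suc t) i" for t i j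
  define u where "u m i = transition s m k i / y (s + m) i" for m i
  have M_nonneg: "0 \<le> M t i j" for t i j
    using y_nonneg w_nonneg by (simp add: M_def del: push_y.simps(2))
  have M_arc: "\<beta> * \<eta> / real CARD('n) \<le> M t i j" if "(j, i) \<in> E t" for t i j
    unfolding M_def
  proof (rule frac_le)
    show "\<beta> * \<eta> \<le> w t i j * y t j"
      using \<beta> \<eta>_pos y_ge[of t j] w_arc[OF that] by (intro mult_mono) auto
  qed (simp_all add: y_le y_pos y_nonneg w_nonneg del: push_y.simps(2))
  have M_row: "(\<Sum>j\<in>UNIV. M t i j) = 1" for t i
    using y_pos[of "Suc t" i] unfolding M_def sum_divide_distrib[symmetric] y_Suc[symmetric] by simp
  have u_Suc: "u (Suc m) i = (\<Sum>j\<in>UNIV. M (s + m) i j * u m j)" for m i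
  proof -
    have "M (s + m) i j * u m j = w (s + m) i j * transition s m k j / y (s + Suc m) i" for j
      using y_pos[of "s + m" j] by (simp add: M_def u_def del: push_y.simps(2))
    then show ?thesis
      by (simp add: u_def sum_divide_distrib del: push_y.simps(2))
  qed
  have start: "u 0 i - u 0 j \<le> 1 / \<eta>" for i j
  proof -
    have "u 0 i \<le> 1 / y s i" "0 \<le> u 0 j" using y_nonneg[of s] by (auto simp: u_def)
    moreover have "1 / y s i \<le> 1 / \<eta>" using y_ge \<eta>_pos by (intro divide_left_mono) (auto simp: y_pos)
    ultimately show ?thesis by linarith
  qed
  have gap: "u m i - u m j \<le> rate m" for i j
    using averaging_contracts[where E = E and M = M and u = u and s = s and m = m and i = i and j = j,
        OF self_arc connected L M_nonneg M_arc arc_bound_pos arc_bound_le_1 M_row u_Suc start]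
    by (simp add: rate_def contraction_def block_def)
  have "real CARD('n) * (u m i - 1 / real CARD('n)) = (\<Sum>j\<in>UNIV. y (s + m) j * (u m i - u m j))"
  proof -
    have "(\<Sum>j\<in>UNIV. y (s + m) j * (u m i - u m j))
        = (\<Sum>j\<in>UNIV. y (s + m) j) * u m i - (\<Sum>j\<in>UNIV. y (s + m) j * u m j)"
      by (simp add: right_diff_distrib sum_subtractf sum_distrib_right)
    also have "(\<Sum>j\<in>UNIV. y (s + m) j * u m j) = (\<Sum>j\<in>UNIV. transition s m k j)"
      using y_pos by (intro sum.cong) (auto simp: u_def less_imp_neq[symmetric])
    finally show ?thesis by (simp add: y_sum transition_sum right_diff_distrib)
  qed
  then have "real CARD('n) * \<bar>u m i - 1 / real CARD('n)\<bar> = \<bar>\<Sum>j\<in>UNIV. y (s + m) j * (u m i - u m j)\<bar>"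
    by (metis abs_mult abs_of_nat)
  also have "\<dots> \<le> (\<Sum>j\<in>UNIV. y (s + m) j * rate m)"
    using gap by (intro order_trans[OF sum_abs] sum_mono)
      (auto simp: abs_mult y_nonneg abs_le_iff intro!: mult_left_mono)
  also have "\<dots> = real CARD('n) * rate m" by (simp add: y_sum flip: sum_distrib_right)
  finally show ?thesis by (simp add: u_def)
qed

end

section \<open>Stepsizes weighted by the disagreement\<close>

text \<open>
  A nonnegative matrix whose row and column sums are at most \<open>R\<close> has Euclidean operator norm at most
  \<open>R\<close>. For the quadratic form this follows from
  \<open>2 a\<^sub>t a\<^sub>s \<le> a\<^sub>t\<^sup>2 + a\<^sub>s\<^sup>2\<close>.
\<close>
lemma Schur_test:
  fixes h :: "nat \<Rightarrow> nat \<Rightarrow> real"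
  assumes h: "\<And>t s. 0 \<le> h t s"
    and row: "\<And>t. (\<Sum>s<T. h t s) \<le> R" and column: "\<And>s. (\<Sum>t<T. h t s) \<le> R"
  shows "(\<Sum>t<T. \<Sum>s<T. a t * a s * h t s) \<le> R * (\<Sum>t<T. (a t)\<^sup>2)"
proof -
  have "(\<Sum>t<T. \<Sum>s<T. a t * a s * h t s)
      \<le> (\<Sum>t<T. \<Sum>s<T. ((a t)\<^sup>2 * h t s + (a s)\<^sup>2 * h t s) / 2)"
  proof (intro sum_mono)
    fix t s
    have "a t * a s \<le> ((a t)\<^sup>2 + (a s)\<^sup>2) / 2"
      using sum_squares_bound[of "a t" "a s"] by simp
    from mult_right_mono[OF this h[of t s]]
    show "a t * a s * h t s \<le> ((a t)\<^sup>2 * h t s + (a s)\<^sup>2 * h t s) / 2"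
      by (simp add: algebra_simps)
  qed
  also have "\<dots> = ((\<Sum>t<T. \<Sum>s<T. (a t)\<^sup>2 * h t s) + (\<Sum>t<T. \<Sum>s<T. (a s)\<^sup>2 * h t s)) / 2"
    by (simp add: sum.distrib flip: sum_divide_distrib)
  also have "(\<Sum>t<T. \<Sum>s<T. (a s)\<^sup>2 * h t s) = (\<Sum>s<T. \<Sum>t<T. (a s)\<^sup>2 * h t s)"
    by (rule sum.swap)
  also have "(\<Sum>t<T. \<Sum>s<T. (a t)\<^sup>2 * h t s) = (\<Sum>t<T. (a t)\<^sup>2 * (\<Sum>s<T. h t s))"
    by (simp add: sum_distrib_left)
  also have "(\<Sum>s<T. \<Sum>t<T. (a s)\<^sup>2 * h t s) = (\<Sum>s<T. (a s)\<^sup>2 * (\<Sum>t<T. h t s))"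
    by (simp add: sum_distrib_left)
  also have "((\<Sum>t<T. (a t)\<^sup>2 * (\<Sum>s<T. h t s)) + (\<Sum>s<T. (a s)\<^sup>2 * (\<Sum>t<T. h t s))) / 2
      \<le> ((\<Sum>t<T. (a t)\<^sup>2 * R) + (\<Sum>s<T. (a s)\<^sup>2 * R)) / 2"
    by (intro divide_right_mono add_mono sum_mono mult_left_mono row column) auto
  also have "\<dots> = R * (\<Sum>t<T. (a t)\<^sup>2)"
    by (simp add: sum_distrib_left mult.commute)
  finally show ?thesis .
qed

lemma sum_reindexed_le_suminf:
  fixes r :: "nat \<Rightarrow> real"
  assumes "summable r" "\<And>m. 0 \<le> r m" "finite A" "inj_on k A"
  shows "(\<Sum>s\<in>A. r (k s)) \<le> suminf r"
proof -
  have "(\<Sum>s\<in>A. r (k s)) = sum r (k ` A)"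
    using sum.reindex[OF assms(4), of r] by simp
  also have "\<dots> \<le> suminf r"
    using assms by (intro sum_le_suminf) auto
  finally show ?thesis .
qed

text \<open>
  The summands weight the disagreement caused by the earlier steps \<open>a s\<close> with the present step \<open>a t\<close>.
  The kernel \<open>h\<close> is the strictly lower triangular Toeplitz matrix of \<open>r\<close>.
\<close>
lemma convolution_quadratic_bound:
  fixes a r :: "nat \<Rightarrow> real"
  assumes r: "summable r" "\<And>m. 0 \<le> r m"
  shows "(\<Sum>t<T. a t * (\<Sum>s<t. a s * r (t - s))) \<le> suminf r * (\<Sum>t<T. (a t)\<^sup>2)"
proof -
  define h where "h t s = (if s < t then r (t - s) else 0)" for t s
  have "(\<Sum>t<T. a t * (\<Sum>s<t. a s * r (t - s))) = (\<Sum>t<T. \<Sum>s<T. a t * a s * h t s)"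
  proof (intro sum.cong refl)
    fix t assume "t \<in> {..<T}"
    then have "(\<Sum>s<T. a t * a s * h t s) = (\<Sum>s<t. a t * a s * h t s)"
      by (intro sum.mono_neutral_right) (auto simp: h_def)
    then show "a t * (\<Sum>s<t. a s * r (t - s)) = (\<Sum>s<T. a t * a s * h t s)"
      by (simp add: h_def sum_distrib_left mult.assoc)
  qed
  also have "\<dots> \<le> suminf r * (\<Sum>t<T. (a t)\<^sup>2)"
  proof (rule Schur_test)
    show "0 \<le> h t s" for t s by (simp add: h_def r)
    show "(\<Sum>s<T. h t s) \<le> suminf r" for t
    proof -
      have "(\<Sum>s<T. h t s) = (\<Sum>s\<in>{..<T} \<inter> {..<t}. r (t - s))"
        by (simp add: h_def sum.inter_restrict)
      also have "\<dots> \<le> suminf r"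
        by (rule sum_reindexed_le_suminf[OF r]) (auto simp: inj_on_def)
      finally show ?thesis .
    qed
    show "(\<Sum>t<T. h t s) \<le> suminf r" for s
    proof -
      have "(\<Sum>t<T. h t s) = (\<Sum>t\<in>{..<T} \<inter> {s<..}. r (t - s))"
        by (simp add: h_def sum.inter_restrict)
      also have "\<dots> \<le> suminf r"
        by (rule sum_reindexed_le_suminf[OF r]) (auto simp: inj_on_def)
      finally show ?thesis .
    qed
  qed
  finally show ?thesis .
qed

section \<open>The subgradient-push iterates\<close>

lemma convex_avg_objective:
  fixes f :: "'n::finite \<Rightarrow> 'a::real_vector \<Rightarrow> real"
  assumes convex: "\<And>i. convex_on UNIV (f i)"
  shows "convex_on UNIV (avg_objective f)"
proof (rule convex_onI)
  fix t :: real and x y :: 'a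
  assume t: "0 < t" "t < 1"
  have "avg_objective f ((1 - t) *\<^sub>R x + t *\<^sub>R y)
      \<le> mean (\<lambda>i. (1 - t) *\<^sub>R f i x - (- t) *\<^sub>R f i y)"
    unfolding avg_objective_mean using convex_onD[OF convex] t by (intro mean_mono) auto
  then show "avg_objective f ((1 - t) *\<^sub>R x + t *\<^sub>R y)
      \<le> (1 - t) * avg_objective f x + t * avg_objective f y"
    unfolding mean_diff mean_scaleR by (simp add: avg_objective_mean)
qed simp

context push_network
begin

lemma push_x_Suc:
  fixes x0 :: "'n \<Rightarrow> 'a::real_vector"
  shows "push_x E w x0 \<alpha> g (Suc t) i
    = (\<Sum>j\<in>UNIV. w t i j *\<^sub>R (push_x E w x0 \<alpha> g t j - \<alpha> t *\<^sub>R g t j))"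
  using sum_in_nbrs[where v = "\<lambda>j. push_x E w x0 \<alpha> g t j - \<alpha> t *\<^sub>R g t j"] by simp

lemma transition_Suc_scaleR:
  fixes v :: "'n \<Rightarrow> 'a::real_vector"
  shows "(\<Sum>k\<in>UNIV. transition s (Suc m) k i *\<^sub>R v k)
    = (\<Sum>j\<in>UNIV. w (s + m) i j *\<^sub>R (\<Sum>k\<in>UNIV. transition s m k j *\<^sub>R v k))"
  by (simp add: scaleR_sum_left scaleR_sum_right) (rule sum.swap)

lemma transition_0_scaleR:
  fixes v :: "'n \<Rightarrow> 'a::real_vector"
  shows "(\<Sum>k\<in>UNIV. transition s 0 k i *\<^sub>R v k) = v i"
  by (simp add: if_distrib[of "\<lambda>c. c *\<^sub>R _"] cong: if_cong)

text \<open>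
  The recursion for \<open>x\<close> is linear, so each initial value and each subgradient step can be followed
  separately through the network. This reduces the vector iterates to the scalar \<open>transition\<close>.
\<close>
lemma push_x_superposition:
  fixes x0 :: "'n \<Rightarrow> 'a::real_vector"
  shows "push_x E w x0 \<alpha> g t i = (\<Sum>k\<in>UNIV. transition 0 t k i *\<^sub>R x0 k)
    - (\<Sum>s<t. \<alpha> s *\<^sub>R (\<Sum>k\<in>UNIV. transition s (t - s) k i *\<^sub>R g s k))"
proof (induction t arbitrary: i)
  case 0
  show ?case using transition_0_scaleR[of 0 i x0] by simp
next
  case (Suc t)
  have "(\<Sum>s<Suc t. \<alpha> s *\<^sub>R (\<Sum>k\<in>UNIV. transition s (Suc t - s) k i *\<^sub>R g s k))
      = (\<Sum>s<Suc t. \<alpha> s *\<^sub>R (\<Sum>j\<in>UNIV. w t i j *\<^sub>R (\<Sum>k\<in>UNIV. transition s (t - s) k j *\<^sub>R g s k)))"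
  proof (rule sum.cong[OF refl])
    fix s assume "s \<in> {..<Suc t}"
    then have "Suc t - s = Suc (t - s)" "s + (t - s) = t" by auto
    then show "\<alpha> s *\<^sub>R (\<Sum>k\<in>UNIV. transition s (Suc t - s) k i *\<^sub>R g s k)
        = \<alpha> s *\<^sub>R (\<Sum>j\<in>UNIV. w t i j *\<^sub>R (\<Sum>k\<in>UNIV. transition s (t - s) k j *\<^sub>R g s k))"
      using transition_Suc_scaleR[of s "t - s" i "g s"] by (simp only:)
  qed
  also have "\<dots> = (\<Sum>j\<in>UNIV. w t i j *\<^sub>R
      (\<Sum>s<Suc t. \<alpha> s *\<^sub>R (\<Sum>k\<in>UNIV. transition s (t - s) k j *\<^sub>R g s k)))"
    unfolding scaleR_sum_right[of _ _ "{..<Suc t}"] scaleR_sum_right[of "\<alpha> _" _ UNIV]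
      scaleR_left_commute[of "\<alpha> _" "w _ _ _"]
    by (rule sum.swap)
  also have "\<dots> = (\<Sum>j\<in>UNIV. w t i j *\<^sub>R
      ((\<Sum>s<t. \<alpha> s *\<^sub>R (\<Sum>k\<in>UNIV. transition s (t - s) k j *\<^sub>R g s k)) + \<alpha> t *\<^sub>R g t j))"
    unfolding sum.lessThan_Suc diff_self_eq_0 transition_0_scaleR by (rule refl)
  finally have noise: "(\<Sum>s<Suc t. \<alpha> s *\<^sub>R (\<Sum>k\<in>UNIV. transition s (Suc t - s) k i *\<^sub>R g s k)) = \<dots>" .
  have start: "(\<Sum>k\<in>UNIV. transition 0 (Suc t) k i *\<^sub>R x0 k)
      = (\<Sum>j\<in>UNIV. w t i j *\<^sub>R (\<Sum>k\<in>UNIV. transition 0 t k j *\<^sub>R x0 k))"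
    using transition_Suc_scaleR[of 0 t i x0] by simp
  show ?case
    unfolding push_x_Suc noise start Suc.IH sum_subtractf[symmetric] scaleR_diff_right[symmetric]
    by (simp only: diff_diff_add)
qed

lemma mean_push_x_Suc:
  fixes x0 :: "'n \<Rightarrow> 'a::real_vector"
  shows "mean (push_x E w x0 \<alpha> g (Suc t)) = mean (push_x E w x0 \<alpha> g t) - \<alpha> t *\<^sub>R mean (g t)"
proof -
  have "mean (push_x E w x0 \<alpha> g (Suc t)) = mean (\<lambda>j. push_x E w x0 \<alpha> g t j - \<alpha> t *\<^sub>R g t j)"
    unfolding mean_def push_x_Suc mass_preserved by (rule refl)
  then show ?thesis by (simp add: mean_diff mean_scaleR)
qed

lemma mean_push_x:
  fixes x0 :: "'n \<Rightarrow> 'a::real_vector"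
  shows "mean (push_x E w x0 \<alpha> g t) = mean x0 - (\<Sum>s<t. \<alpha> s *\<^sub>R mean (g s))"
  by (induction t) (simp_all add: mean_push_x_Suc del: push_x.simps(2))

definition disagreement_bound :: "('n \<Rightarrow> 'a::real_normed_vector) \<Rightarrow> (nat \<Rightarrow> real) \<Rightarrow> real \<Rightarrow> nat \<Rightarrow> real" where
  "disagreement_bound x0 \<alpha> G t =
     rate t * (\<Sum>k\<in>UNIV. norm (x0 k)) + real CARD('n) * G * (\<Sum>s<t. \<alpha> s * rate (t - s))"

text \<open>
  Both sides of the difference are the same superposition, with coefficients
  \<open>transition / y\<close> for the ratio and \<open>1 / n\<close> for the mean; \<open>transition_mixes\<close> compares the coefficients.
\<close>
lemma push_z_near_mean:
  fixes x0 :: "'n \<Rightarrow> 'a::real_normed_vector"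
  assumes \<alpha>: "\<And>s. s < t \<Longrightarrow> 0 \<le> \<alpha> s"
    and g: "\<And>s k. s < t \<Longrightarrow> norm (g s k) \<le> G"
  shows "norm (push_z E w x0 \<alpha> g t i - mean (push_x E w x0 \<alpha> g t)) \<le> disagreement_bound x0 \<alpha> G t"
proof -
  define c where "c s k = transition s (t - s) k i / y t i - 1 / real CARD('n)" for s k
  have c: "\<bar>c s k\<bar> \<le> rate (t - s)" if "s \<le> t" for s k
    using transition_mixes[of s "t - s" k i] that by (simp add: c_def)
  have deviation: "(\<Sum>k\<in>UNIV. transition s (t - s) k i *\<^sub>R v k) /\<^sub>R y t i - mean v
      = (\<Sum>k\<in>UNIV. c s k *\<^sub>R v k)" for s and v :: "'n \<Rightarrow> 'a"
    by (simp add: c_def mean_def scaleR_diff_left sum_subtractf scaleR_sum_right divide_inverse mult.commute)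
  have "push_z E w x0 \<alpha> g t i - mean (push_x E w x0 \<alpha> g t)
      = ((\<Sum>k\<in>UNIV. transition 0 (t - 0) k i *\<^sub>R x0 k) /\<^sub>R y t i - mean x0)
        - (\<Sum>s<t. \<alpha> s *\<^sub>R ((\<Sum>k\<in>UNIV. transition s (t - s) k i *\<^sub>R g s k) /\<^sub>R y t i - mean (g s)))"
    unfolding push_z_def push_x_superposition[of _ _ _ _ i] mean_push_x
    by (simp add: scaleR_diff_right sum_subtractf scaleR_sum_right[of _ _ "{..<t}"]
        mult.commute)
  also have "\<dots> = (\<Sum>k\<in>UNIV. c 0 k *\<^sub>R x0 k) - (\<Sum>s<t. \<alpha> s *\<^sub>R (\<Sum>k\<in>UNIV. c s k *\<^sub>R g s k))"
    unfolding deviation by (rule refl)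
  also have "norm \<dots> \<le> norm (\<Sum>k\<in>UNIV. c 0 k *\<^sub>R x0 k)
      + norm (\<Sum>s<t. \<alpha> s *\<^sub>R (\<Sum>k\<in>UNIV. c s k *\<^sub>R g s k))"
    by (rule norm_triangle_ineq4)
  also have "norm (\<Sum>k\<in>UNIV. c 0 k *\<^sub>R x0 k) \<le> (\<Sum>k\<in>UNIV. rate t * norm (x0 k))"
    using c[of 0] by (intro sum_norm_le) (auto intro: mult_right_mono)
  also have "norm (\<Sum>s<t. \<alpha> s *\<^sub>R (\<Sum>k\<in>UNIV. c s k *\<^sub>R g s k))
      \<le> (\<Sum>s<t. \<alpha> s * (\<Sum>k\<in>(UNIV::'n set). rate (t - s) * G))"
  proof (intro sum_norm_le)
    fix s assume "s \<in> {..<t}"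
    then have s: "s < t" by simp
    have "norm (\<Sum>k\<in>UNIV. c s k *\<^sub>R g s k) \<le> (\<Sum>k\<in>(UNIV::'n set). rate (t - s) * G)"
    proof (intro sum_norm_le)
      fix k
      show "norm (c s k *\<^sub>R g s k) \<le> rate (t - s) * G"
        using c[of s k] g[OF s, of k] s rate_nonneg by (auto intro: mult_mono)
    qed
    then show "norm (\<alpha> s *\<^sub>R (\<Sum>k\<in>UNIV. c s k *\<^sub>R g s k))
        \<le> \<alpha> s * (\<Sum>k\<in>(UNIV::'n set). rate (t - s) * G)"
      using \<alpha>[OF s] by (simp add: mult_left_mono del: sum_constant)
  qed
  finally show ?thesis
    by (simp add: disagreement_bound_def sum_distrib_left mult_ac)
qed

lemma rate_sum_le:
  assumes "finite S" "inj_on k S"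
  shows "(\<Sum>s\<in>S. rate (k s)) \<le> suminf rate"
  using assms by (intro sum_reindexed_le_suminf rate_summable rate_nonneg)

lemma weighted_rate_le:
  fixes T t :: nat
  assumes squares: "(\<Sum>t<T. (\<alpha> t)\<^sup>2) \<le> A" and "t \<le> T" "inj_on k {..<t}"
  shows "(\<Sum>s<t. \<alpha> s * rate (k s)) \<le> sqrt A * suminf rate"
proof -
  have \<alpha>_le: "\<alpha> s \<le> sqrt A" if "s < T" for s
  proof -
    have "(\<alpha> s)\<^sup>2 \<le> (\<Sum>t<T. (\<alpha> t)\<^sup>2)"
      using that by (intro member_le_sum) auto
    then show ?thesis using squares by (intro real_le_rsqrt) simp
  qed
  have "(\<Sum>s<t. \<alpha> s * rate (k s)) \<le> (\<Sum>s<t. sqrt A * rate (k s))"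
    using assms \<alpha>_le by (intro sum_mono mult_right_mono rate_nonneg) auto
  also have "\<dots> = sqrt A * (\<Sum>s<t. rate (k s))" by (simp add: sum_distrib_left)
  also have "\<dots> \<le> sqrt A * suminf rate"
  proof (rule mult_left_mono)
    have "0 \<le> (\<Sum>t<T. (\<alpha> t)\<^sup>2)" by (simp add: sum_nonneg)
    then show "0 \<le> sqrt A" using squares by simp
  qed (use assms rate_sum_le in auto)
  finally show ?thesis .
qed

lemma disagreement_bound_le:
  assumes squares: "(\<Sum>t<T. (\<alpha> t)\<^sup>2) \<le> A" and "t < T" "0 \<le> G"
  shows "disagreement_bound x0 \<alpha> G t
    \<le> suminf rate * (\<Sum>k\<in>UNIV. norm (x0 k)) + real CARD('n) * G * (sqrt A * suminf rate)"
proof -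
  have "rate t \<le> suminf rate" using rate_sum_le[of "{t}" id] by simp
  moreover have "(\<Sum>s<t. \<alpha> s * rate (t - s)) \<le> sqrt A * suminf rate"
    using assms by (intro weighted_rate_le[OF squares]) (auto simp: inj_on_def)
  ultimately show ?thesis
    unfolding disagreement_bound_def using \<open>0 \<le> G\<close>
    by (intro add_mono mult_left_mono mult_right_mono) (auto simp: sum_nonneg)
qed

lemma weighted_disagreement_le:
  assumes squares: "(\<Sum>t<T. (\<alpha> t)\<^sup>2) \<le> A" and "0 \<le> G"
  shows "(\<Sum>t<T. \<alpha> t * disagreement_bound x0 \<alpha> G t)
    \<le> sqrt A * suminf rate * (\<Sum>k\<in>UNIV. norm (x0 k)) + real CARD('n) * G * (suminf rate * A)"
proof -
  let ?X = "\<Sum>k\<in>UNIV. norm (x0 k)" and ?N = "real CARD('n) * G"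
  have "(\<Sum>t<T. \<alpha> t * disagreement_bound x0 \<alpha> G t)
      = (\<Sum>t<T. \<alpha> t * rate t * ?X + ?N * (\<alpha> t * (\<Sum>s<t. \<alpha> s * rate (t - s))))"
    unfolding disagreement_bound_def by (intro sum.cong refl) (simp only: distrib_left mult_ac)
  also have "\<dots> = (\<Sum>t<T. \<alpha> t * rate t) * ?X + ?N * (\<Sum>t<T. \<alpha> t * (\<Sum>s<t. \<alpha> s * rate (t - s)))"
    by (simp only: sum.distrib sum_distrib_right[of _ _ ?X] sum_distrib_left[of ?N])
  also have "\<dots> \<le> sqrt A * suminf rate * ?X + ?N * (suminf rate * A)"
  proof (intro add_mono mult_left_mono mult_right_mono)
    show "(\<Sum>t<T. \<alpha> t * rate t) \<le> sqrt A * suminf rate"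
      using weighted_rate_le[OF squares, of T id] by simp
    have "(\<Sum>t<T. \<alpha> t * (\<Sum>s<t. \<alpha> s * rate (t - s))) \<le> suminf rate * (\<Sum>t<T. (\<alpha> t)\<^sup>2)"
      by (intro convolution_quadratic_bound rate_summable rate_nonneg)
    also have "\<dots> \<le> suminf rate * A"
      using squares rate_sum_le[of "{}" id] by (intro mult_left_mono) auto
    finally show "(\<Sum>t<T. \<alpha> t * (\<Sum>s<t. \<alpha> s * rate (t - s))) \<le> suminf rate * A" .
  qed (use \<open>0 \<le> G\<close> in \<open>auto simp: sum_nonneg\<close>)
  finally show ?thesis .
qed

text \<open>
  As before \<open>r\<close> ranges over runs sharing the network, the objective and \<open>x0\<close>. The constant may depend
  on the stepsizes only through \<open>A\<close>, which is what allows a fixed-horizon stepsize that changes with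
  the horizon.
\<close>
theorem weighted_average_gap:
  fixes f :: "'n \<Rightarrow> 'a::euclidean_space \<Rightarrow> real"
    and T :: "'r \<Rightarrow> nat" and \<alpha> :: "'r \<Rightarrow> nat \<Rightarrow> real" and g :: "'r \<Rightarrow> nat \<Rightarrow> 'n \<Rightarrow> 'a"
  assumes convex: "\<And>i. convex_on UNIV (f i)"
    and minimizer: "\<And>z. avg_objective f zs \<le> avg_objective f z"
    and choice: "\<And>r. r \<in> I \<Longrightarrow> subgradient_choice E w f x0 (\<alpha> r) (g r) {..<T r}"
    and g: "\<And>r t i. r \<in> I \<Longrightarrow> t < T r \<Longrightarrow> norm (g r t i) \<le> G"
    and \<alpha>: "\<And>r t. r \<in> I \<Longrightarrow> t < T r \<Longrightarrow> 0 \<le> \<alpha> r t"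
    and squares: "\<And>r. r \<in> I \<Longrightarrow> (\<Sum>t<T r. (\<alpha> r t)\<^sup>2) \<le> A"
    and total: "\<And>r. r \<in> I \<Longrightarrow> 0 < (\<Sum>t<T r. \<alpha> r t)"
  obtains C where "\<And>r. r \<in> I \<Longrightarrow>
      avg_objective f ((\<Sum>t<T r. \<alpha> r t *\<^sub>R push_zbar E w x0 (\<alpha> r) (g r) t) /\<^sub>R (\<Sum>t<T r. \<alpha> r t))
        - avg_objective f zs \<le> C / (\<Sum>t<T r. \<alpha> r t)"
proof -
  have G: "norm (g r t i) \<le> \<bar>G\<bar>" if "r \<in> I" "t < T r" for r t i
    using g[OF that, of i] by linarith
  obtain C where C: "\<And>r. r \<in> I \<Longrightarrow>
      (\<Sum>t<T r. \<alpha> r t * (avg_objective f (mean (push_z E w x0 (\<alpha> r) (g r) t)) - avg_objective f zs)) \<le> C"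
  proof (rule disagreeing_descent_weighted_gap[where f = f and zs = zs and I = I and T = T and \<alpha> = \<alpha>
        and g = g and z = "\<lambda>r. push_z E w x0 (\<alpha> r) (g r)" and G = "\<bar>G\<bar>" and A = A
        and x = "\<lambda>r t. mean (push_x E w x0 (\<alpha> r) (g r) t)" and b = "mean x0"
        and \<epsilon> = "\<lambda>r. disagreement_bound x0 (\<alpha> r) \<bar>G\<bar>", OF convex minimizer _ G \<alpha>])
    show "is_subgradient (f i) (push_z E w x0 (\<alpha> r) (g r) t i) (g r t i)"
      if "r \<in> I" "t < T r" for r t i
      using choice that by (simp add: subgradient_choice_def)
    show "norm (push_z E w x0 (\<alpha> r) (g r) t i - mean (push_x E w x0 (\<alpha> r) (g r) t))
        \<le> disagreement_bound x0 (\<alpha> r) \<bar>G\<bar> t" if "r \<in> I" "t < T r" for r t i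
      using that by (intro push_z_near_mean \<alpha> G) auto
    show "disagreement_bound x0 (\<alpha> r) \<bar>G\<bar> t \<le> suminf rate * (\<Sum>k\<in>UNIV. norm (x0 k))
        + real CARD('n) * \<bar>G\<bar> * (sqrt A * suminf rate)" if "r \<in> I" "t < T r" for r t
      using that by (intro disagreement_bound_le[OF squares]) auto
    show "(\<Sum>t<T r. \<alpha> r t * disagreement_bound x0 (\<alpha> r) \<bar>G\<bar> t)
        \<le> sqrt A * suminf rate * (\<Sum>k\<in>UNIV. norm (x0 k)) + real CARD('n) * \<bar>G\<bar> * (suminf rate * A)"
      if "r \<in> I" for r
      using that by (intro weighted_disagreement_le squares) auto
  qed (auto simp: mean_push_x_Suc squares simp del: push_x.simps(2))
  show ?thesis
  proof (rule that[of C])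
    fix r assume r: "r \<in> I"
    let ?T = "T r" and ?\<alpha> = "\<alpha> r" and ?zbar = "push_zbar E w x0 (\<alpha> r) (g r)"
    let ?S = "\<Sum>t<T r. \<alpha> r t"
    note \<alpha> = \<alpha>[OF r] and pos = total[OF r]
    have "mean (push_z E w x0 (\<alpha> r) (g r) t) = ?zbar t" for t
      by (simp add: push_zbar_def mean_def)
    then have total: "(\<Sum>t<?T. ?\<alpha> t * avg_objective f (?zbar t)) - ?S * avg_objective f zs \<le> C"
      using C[OF r] by (simp add: right_diff_distrib sum_subtractf sum_distrib_right)
    have T: "{..<?T} \<noteq> {}" using pos by auto
    have "avg_objective f ((\<Sum>t<?T. ?\<alpha> t *\<^sub>R ?zbar t) /\<^sub>R ?S)
        = avg_objective f (\<Sum>t<?T. (?\<alpha> t / ?S) *\<^sub>R ?zbar t)"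
      by (simp add: scaleR_sum_right divide_inverse mult.commute)
    also have "\<dots> \<le> (\<Sum>t<?T. (?\<alpha> t / ?S) * avg_objective f (?zbar t))"
      using T pos \<alpha>
      by (intro convex_on_sum[where C = UNIV] convex_avg_objective convex)
        (auto simp flip: sum_divide_distrib)
    also have "\<dots> = (\<Sum>t<?T. ?\<alpha> t * avg_objective f (?zbar t)) / ?S"
      by (simp add: sum_divide_distrib)
    finally have "avg_objective f ((\<Sum>t<?T. ?\<alpha> t *\<^sub>R ?zbar t) /\<^sub>R ?S) - avg_objective f zs
        \<le> ((\<Sum>t<?T. ?\<alpha> t * avg_objective f (?zbar t)) - ?S * avg_objective f zs) / ?S"
      using pos by (simp add: diff_divide_distrib)
    also have "\<dots> \<le> C / ?S" using total pos by (intro divide_right_mono) auto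
    finally show "avg_objective f ((\<Sum>t<?T. ?\<alpha> t *\<^sub>R ?zbar t) /\<^sub>R ?S) - avg_objective f zs \<le> C / ?S" .
  qed
qed

end

lemma push_network_exists:
  assumes self_arcs: "\<And>t i. (i, i) \<in> E t"
    and connected: "uniformly_strongly_connected E"
    and weights: "push_weights E w"
  obtains L \<beta> where "push_network E w L \<beta>"
proof -
  obtain L where L: "0 < L" "\<And>t. strongly_connected (with_proj (union_graph E {t..<t + L}))"
    using connected unfolding uniformly_strongly_connected_def by blast
  obtain \<beta> where \<beta>: "0 < \<beta>" "\<And>t i j. (j, i) \<in> E t \<Longrightarrow> \<beta> \<le> w t i j"
    using weights unfolding push_weights_def in_nbrs_def by auto
  have no_arc: "w t i j = 0" if "(j, i) \<notin> E t" for t i j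
    using weights that unfolding push_weights_def in_nbrs_def by auto
  have "(\<Sum>i\<in>UNIV. w t i j) = (\<Sum>i\<in>out_nbrs E t j. w t i j)" for t j
    by (rule sum.mono_neutral_right) (auto simp: out_nbrs_def no_arc)
  also have "(\<Sum>i\<in>out_nbrs E t j. w t i j) = 1" for t j
    using weights unfolding push_weights_def by blast
  finally have "push_network E w L \<beta>"
    using self_arcs L \<beta> no_arc by unfold_locales auto
  then show ?thesis by (rule that)
qed

theorem theorem1:
  fixes E :: "nat \<Rightarrow> ('n::finite \<times> 'n) set"
    and w :: "nat \<Rightarrow> 'n \<Rightarrow> 'n \<Rightarrow> real"
    and f :: "'n \<Rightarrow> real ^ 'd \<Rightarrow> real"
    and x0 :: "'n \<Rightarrow> real ^ 'd"
    and zstar :: "real ^ 'd"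
  assumes self_arcs: "\<And>t i. (i, i) \<in> E t"
    and connected: "uniformly_strongly_connected E"
    and weights: "push_weights E w"
    and convex: "\<And>i. convex_on UNIV (f i)"
    and minimizer: "is_arg_min (avg_objective f) (\<lambda>z. True) zstar"
  shows
    "(\<forall>(\<alpha> :: nat \<Rightarrow> real) (g :: nat \<Rightarrow> 'n \<Rightarrow> real ^ 'd).
        (\<forall>t. \<alpha> t > 0) \<and> decseq \<alpha> \<and>
        filterlim (\<lambda>t. \<Sum>\<tau>\<le>t. \<alpha> \<tau>) at_top sequentially \<and>
        summable (\<lambda>t. (\<alpha> t)\<^sup>2) \<and>
        subgradient_choice E w f x0 \<alpha> g UNIV \<and>
        (\<exists>G. \<forall>t i. norm (g t i) \<le> G) \<longrightarrow>
        (\<lambda>t. avg_objective f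
                ((\<Sum>\<tau>\<le>t. \<alpha> \<tau> *\<^sub>R push_zbar E w x0 \<alpha> g \<tau>) /\<^sub>R (\<Sum>\<tau>\<le>t. \<alpha> \<tau>)))
          \<longlonglongrightarrow> avg_objective f zstar)
     \<and>
     (\<forall>g :: nat \<Rightarrow> nat \<Rightarrow> 'n \<Rightarrow> real ^ 'd.
        (\<forall>T>0. subgradient_choice E w f x0 (\<lambda>t. 1 / sqrt (real T)) (g T) {..<T}) \<and>
        (\<exists>G. \<forall>T>0. \<forall>t<T. \<forall>i. norm (g T t i) \<le> G) \<longrightarrow>
        (\<exists>C. \<forall>T>0.
           avg_objective f
             ((\<Sum>\<tau><T. push_zbar E w x0 (\<lambda>t. 1 / sqrt (real T)) (g T) \<tau>) /\<^sub>R real T)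
           - avg_objective f zstar \<le> C / sqrt (real T)))"
proof -
  obtain L \<beta> where "push_network E w L \<beta>"
    using push_network_exists[of E w] self_arcs connected weights by blast
  then interpret push_network E w L \<beta> .
  have optimal: "avg_objective f zstar \<le> avg_objective f z" for z
    using minimizer by (auto simp: is_arg_min_def not_less)
  show ?thesis
  proof (intro conjI allI impI; elim conjE exE)
    fix \<alpha> :: "nat \<Rightarrow> real" and g :: "nat \<Rightarrow> 'n \<Rightarrow> real ^ 'd" and G
    assume \<alpha>: "\<forall>t. \<alpha> t > 0"
      and diverges: "filterlim (\<lambda>t. \<Sum>\<tau>\<le>t. \<alpha> \<tau>) at_top sequentially"
      and squares: "summable (\<lambda>t. (\<alpha> t)\<^sup>2)"
      and choice: "subgradient_choice E w f x0 \<alpha> g UNIV"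
      and G: "\<forall>t i. norm (g t i) \<le> G"
    let ?z = "\<lambda>t. (\<Sum>\<tau>\<le>t. \<alpha> \<tau> *\<^sub>R push_zbar E w x0 \<alpha> g \<tau>) /\<^sub>R (\<Sum>\<tau>\<le>t. \<alpha> \<tau>)"
    \<comment> \<open>The truncations of one infinite run at all horizons \<open>Suc t\<close> are regarded as separate runs.\<close>
    obtain C where upper:
      "\<And>t. avg_objective f (?z t) - avg_objective f zstar \<le> C / (\<Sum>\<tau>\<le>t. \<alpha> \<tau>)"
    proof (rule weighted_average_gap[where f = f and zs = zstar and ?x0.0 = x0 and I = UNIV
          and T = Suc and \<alpha> = "\<lambda>_. \<alpha>" and g = "\<lambda>_. g" and G = G
          and A = "\<Sum>t. (\<alpha> t)\<^sup>2", OF convex optimal])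
      show "subgradient_choice E w f x0 \<alpha> g {..<Suc t}" for t
        using choice by (simp add: subgradient_choice_def)
      show "(\<Sum>\<tau><Suc t. (\<alpha> \<tau>)\<^sup>2) \<le> (\<Sum>\<tau>. (\<alpha> \<tau>)\<^sup>2)" for t
        using squares by (intro sum_le_suminf) auto
      show "0 < (\<Sum>\<tau><Suc t. \<alpha> \<tau>)" for t
        using \<alpha> by (intro sum_pos) auto
      show "norm (g \<tau> i) \<le> G" "0 \<le> \<alpha> \<tau>" for \<tau> i
        using \<alpha> G by (simp_all add: less_imp_le)
    next
      fix C
      assume "\<And>t. t \<in> UNIV \<Longrightarrow>
          avg_objective f ((\<Sum>\<tau><Suc t. \<alpha> \<tau> *\<^sub>R push_zbar E w x0 \<alpha> g \<tau>) /\<^sub>R (\<Sum>\<tau><Suc t. \<alpha> \<tau>))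
            - avg_objective f zstar \<le> C / (\<Sum>\<tau><Suc t. \<alpha> \<tau>)"
      then show thesis using that[of C] by (simp add: lessThan_Suc_atMost)
    qed
    have "(\<lambda>t. avg_objective f (?z t) - avg_objective f zstar) \<longlonglongrightarrow> 0"
    proof (rule tendsto_sandwich[where f = "\<lambda>_. 0"])
      show "(\<lambda>t. C / (\<Sum>\<tau>\<le>t. \<alpha> \<tau>)) \<longlonglongrightarrow> 0"
        by (rule tendsto_divide_0[OF tendsto_const filterlim_at_top_imp_at_infinity[OF diverges]])
      show "\<forall>\<^sub>F t in sequentially. 0 \<le> avg_objective f (?z t) - avg_objective f zstar"
        using optimal by simp
      show "\<forall>\<^sub>F t in sequentially.
          avg_objective f (?z t) - avg_objective f zstar \<le> C / (\<Sum>\<tau>\<le>t. \<alpha> \<tau>)"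
        using upper by simp
    qed simp
    then show "(\<lambda>t. avg_objective f (?z t)) \<longlonglongrightarrow> avg_objective f zstar"
      by (rule LIM_zero_cancel)
  next
    fix g :: "nat \<Rightarrow> nat \<Rightarrow> 'n \<Rightarrow> real ^ 'd" and G
    assume choice: "\<forall>T>0. subgradient_choice E w f x0 (\<lambda>t. 1 / sqrt (real T)) (g T) {..<T}"
      and G: "\<forall>T>0. \<forall>t<T. \<forall>i. norm (g T t i) \<le> G"
    let ?\<alpha> = "\<lambda>(T::nat) (t::nat). 1 / sqrt (real T)"
    have S: "(\<Sum>t<T. ?\<alpha> T t) = sqrt (real T)" for T
      by (simp add: real_div_sqrt)
    obtain C where C: "\<And>T. T \<in> {0<..} \<Longrightarrow>
        avg_objective f ((\<Sum>t<T. ?\<alpha> T t *\<^sub>R push_zbar E w x0 (?\<alpha> T) (g T) t) /\<^sub>R (\<Sum>t<T. ?\<alpha> T t))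
          - avg_objective f zstar \<le> C / (\<Sum>t<T. ?\<alpha> T t)"
    proof (rule weighted_average_gap[where f = f and zs = zstar and ?x0.0 = x0 and I = "{0<..}"
          and T = "\<lambda>T. T" and \<alpha> = ?\<alpha> and g = g and G = G and A = 1, OF convex optimal])
      show "(\<Sum>t<T. (?\<alpha> T t)\<^sup>2) \<le> 1" for T
        by (simp add: power_divide)
      show "0 < (\<Sum>t<T. ?\<alpha> T t)" if "T \<in> {0<..}" for T
        unfolding S using that by simp
      show "subgradient_choice E w f x0 (?\<alpha> T) (g T) {..<T}" if "T \<in> {0<..}" for T
        using choice that by simp
      show "norm (g T t i) \<le> G" if "T \<in> {0<..}" "t < T" for T t i
        using G that by simp
      show "0 \<le> ?\<alpha> T t" for T t
        by simp
    qed (rule that)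
    have "avg_objective f
             ((\<Sum>\<tau><T. push_zbar E w x0 (?\<alpha> T) (g T) \<tau>) /\<^sub>R real T)
           - avg_objective f zstar \<le> C / sqrt (real T)" if T: "T > 0" for T
    proof -
      have "(\<Sum>t<T. ?\<alpha> T t *\<^sub>R push_zbar E w x0 (?\<alpha> T) (g T) t) /\<^sub>R sqrt (real T)
          = (\<Sum>\<tau><T. push_zbar E w x0 (?\<alpha> T) (g T) \<tau>) /\<^sub>R real T"
        unfolding scaleR_sum_right[symmetric] scaleR_scaleR
        by (simp add: inverse_eq_divide)
      then show ?thesis using C[of T] T unfolding S by (simp only: greaterThan_iff)
    qed
    then show "\<exists>C. \<forall>T>0. avg_objective f
             ((\<Sum>\<tau><T. push_zbar E w x0 (?\<alpha> T) (g T) \<tau>) /\<^sub>R real T)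
           - avg_objective f zstar \<le> C / sqrt (real T)"
      by (intro exI[of _ C] allI impI)
  qed
qed

end
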